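(* Let $\epsilon\in\{-1,1\}$ and let $f:M^m\to\mathbb{Q}_\epsilon^n\times\mathbb{R}$ be an isometric immersion of a connected Riemannian manifold. Let $\eta$ be the normal vector field defined by $\frac{\partial}{\partial t}=f_*T+\eta$. Assume that $L:=N_1+\mathrm{span}\{\eta\}$ is a subbundle of the normal bundle $N^fM$ with rank $\ell<n+1-m$ and that $\nabla^\perp N_1\subset L$. Then $f$ reduces codimension to $\ell$, i.e. $f(M^m)$ is contained in a totally geodesic submanifold $\mathbb{Q}_\epsilon^{m+\ell-1}\times\mathbb{R}$ of $\mathbb{Q}_\epsilon^n\times\mathbb{R}$.
   Context: $\mathbb{Q}_1^n=\mathbb{S}^n$, $\mathbb{Q}_{-1}^n=\mathbb{H}^n$. $\partial/\partial t$ is a unit vector field tangent to the factor $\mathbb{R}$ of $\mathbb{Q}_\epsilon^n\times\mathbb{R}$; $T$ is the tangent and $\eta$ the normal component of $\partial/\partial t$ along $f$. $N_1(x)$ is the first normal space of $f$ at $x$, i.e. the subspace of the normal space $N^f_xM$ spanned by the values of the second fundamental form of $f$ at $x$. $\nabla^\perp$ is the normal connection of $f$; $\nabla^\perp N_1\subset L$ means $\nabla^\perp_X\xi\in L$ for every tangent vector $X$ and every local smooth normal section $\xi$ with values in $N_1$. *)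

theory Defs
  imports "HOL-Analysis.Analysis"
begin

section \<open>Smooth maps between Euclidean spaces\<close>

text \<open>These are meant for open domains \<^term>\<open>S\<close>.\<close>

primrec Ck_on :: "nat \<Rightarrow> 'a::euclidean_space set \<Rightarrow> ('a \<Rightarrow> 'b::real_normed_vector) \<Rightarrow> bool" where
  "Ck_on 0 S h \<longleftrightarrow> continuous_on S h"
| "Ck_on (Suc k) S h \<longleftrightarrow> (\<forall>x\<in>S. h differentiable (at x)) \<and>
     (\<forall>v. Ck_on k S (\<lambda>x. frechet_derivative h (at x) v))"

definition smooth_on :: "'a::euclidean_space set \<Rightarrow> ('a \<Rightarrow> 'b::real_normed_vector) \<Rightarrow> bool" where
  "smooth_on S h \<longleftrightarrow> (\<forall>k. Ck_on k S h)"


section \<open>Smooth and Riemannian manifolds\<close>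

text \<open>A chart is a pair of an open domain and a coordinate map.  The manifold is the whole
  type \<open>'p\<close> and its dimension is \<open>DIM('m)\<close>.\<close>

type_synonym ('p, 'm) chart = "'p set \<times> ('p \<Rightarrow> 'm)"

definition param :: "('p, 'm) chart \<Rightarrow> 'm \<Rightarrow> 'p" where
  "param c = inv_into (fst c) (snd c)"

definition charts_at :: "('p, 'm) chart set \<Rightarrow> 'p \<Rightarrow> ('p, 'm) chart set" where
  "charts_at A p = {c \<in> A. p \<in> fst c}"

definition smooth_atlas ::
  "('p::{t2_space, second_countable_topology}, 'm::euclidean_space) chart set \<Rightarrow> bool" where
  "smooth_atlas A \<longleftrightarrow>
     (\<Union>c\<in>A. fst c) = UNIV \<and>
     (\<forall>c\<in>A. open (fst c) \<and> open (snd c ` fst c) \<and>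
        homeomorphism (fst c) (snd c ` fst c) (snd c) (param c)) \<and>
     (\<forall>c\<in>A. \<forall>d\<in>A. smooth_on (snd c ` (fst c \<inter> fst d)) (snd d \<circ> param c))"

definition smooth_map ::
  "('p::topological_space, 'm::euclidean_space) chart set \<Rightarrow> 'p set
     \<Rightarrow> ('p \<Rightarrow> 'b::real_normed_vector) \<Rightarrow> bool" where
  "smooth_map A U h \<longleftrightarrow> (\<forall>c\<in>A. smooth_on (snd c ` (fst c \<inter> U)) (h \<circ> param c))"

text \<open>A tangent vector at \<^term>\<open>p\<close> is given by its components \<^term>\<open>u\<close> with respect to a chart
  \<^term>\<open>c\<close> around \<^term>\<open>p\<close>; \<open>dmap c h p u\<close> is the derivative of \<^term>\<open>h\<close> in this direction.\<close>

definition dmap ::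
  "('p, 'm::euclidean_space) chart \<Rightarrow> ('p \<Rightarrow> 'b::real_normed_vector) \<Rightarrow> 'p \<Rightarrow> 'm \<Rightarrow> 'b" where
  "dmap c h p u = frechet_derivative (h \<circ> param c) (at (snd c p)) u"

text \<open>\<open>g c p u v\<close> is the inner product of the tangent vectors at \<^term>\<open>p\<close> with components
  \<^term>\<open>u\<close>, \<^term>\<open>v\<close> in the chart \<^term>\<open>c\<close>.  The last clause is the transformation law under
  a change of charts, \<^term>\<open>dmap c (snd d) p\<close> being the Jacobian of the transition map.\<close>

definition riemannian_metric ::
  "('p::topological_space, 'm::euclidean_space) chart set
     \<Rightarrow> (('p, 'm) chart \<Rightarrow> 'p \<Rightarrow> 'm \<Rightarrow> 'm \<Rightarrow> real) \<Rightarrow> bool" where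
  "riemannian_metric A g \<longleftrightarrow>
     (\<forall>c\<in>A. \<forall>p\<in>fst c. bilinear (g c p) \<and> (\<forall>u v. g c p u v = g c p v u) \<and>
        (\<forall>u. u \<noteq> 0 \<longrightarrow> g c p u u > 0)) \<and>
     (\<forall>c\<in>A. \<forall>u v. smooth_on (snd c ` fst c) (\<lambda>y. g c (param c y) u v)) \<and>
     (\<forall>c\<in>A. \<forall>d\<in>A. \<forall>p\<in>fst c \<inter> fst d. \<forall>u v.
        g c p u v = g d p (dmap c (snd d) p u) (dmap c (snd d) p v))"


section \<open>The ambient space\<close>

text \<open>With \<open>DIM('n)\<close> in the role of \<open>n\<close>, \<open>Q \<epsilon>\<close> is the unit sphere of Euclidean
  (n+1)-space for \<open>\<epsilon> = 1\<close>, and the upper sheet of the hyperboloid in Lorentzian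
  (n+1)-space for \<open>\<epsilon> = -1\<close>.\<close>

definition form :: "real \<Rightarrow> real \<times> 'n::euclidean_space \<Rightarrow> real \<times> 'n \<Rightarrow> real" where
  "form \<epsilon> x y = \<epsilon> * fst x * fst y + snd x \<bullet> snd y"

definition Q :: "real \<Rightarrow> (real \<times> 'n::euclidean_space) set" where
  "Q \<epsilon> = {x. form \<epsilon> x x = \<epsilon> \<and> (\<epsilon> = -1 \<longrightarrow> fst x > 0)}"

definition QR :: "real \<Rightarrow> ((real \<times> 'n::euclidean_space) \<times> real) set" where
  "QR \<epsilon> = Q \<epsilon> \<times> UNIV"

text \<open>On the tangent spaces of \<open>QR \<epsilon>\<close>, \<open>amb \<epsilon>\<close> is the product Riemannian metric.\<close>

definition amb ::
  "real \<Rightarrow> (real \<times> 'n::euclidean_space) \<times> real \<Rightarrow> (real \<times> 'n) \<times> real \<Rightarrow> real" where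
  "amb \<epsilon> z w = form \<epsilon> (fst z) (fst w) + snd z * snd w"

definition tangent_QR ::
  "real \<Rightarrow> (real \<times> 'n::euclidean_space) \<times> real \<Rightarrow> ((real \<times> 'n) \<times> real) set" where
  "tangent_QR \<epsilon> z = {w. form \<epsilon> (fst w) (fst z) = 0}"

definition dt :: "(real \<times> 'n::euclidean_space) \<times> real" where
  "dt = (0, 1)"

text \<open>Orthogonal projection onto \<open>tangent_QR \<epsilon> z\<close>, for \<open>z \<in> QR \<epsilon>\<close>.  The Levi-Civita
  connection of \<open>QR \<epsilon>\<close> is the flat derivative followed by this projection.\<close>

definition tan_proj ::
  "real \<Rightarrow> (real \<times> 'n::euclidean_space) \<times> real \<Rightarrow> (real \<times> 'n) \<times> real \<Rightarrow> (real \<times> 'n) \<times> real" where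
  "tan_proj \<epsilon> z w = w - (\<epsilon> * form \<epsilon> (fst w) (fst z)) *\<^sub>R (fst z, 0)"


section \<open>Isometric immersions into the ambient space\<close>

definition isometric_immersion ::
  "real \<Rightarrow> ('p::topological_space, 'm::euclidean_space) chart set
     \<Rightarrow> (('p, 'm) chart \<Rightarrow> 'p \<Rightarrow> 'm \<Rightarrow> 'm \<Rightarrow> real)
     \<Rightarrow> ('p \<Rightarrow> (real \<times> 'n::euclidean_space) \<times> real) \<Rightarrow> bool" where
  "isometric_immersion \<epsilon> A g f \<longleftrightarrow>
     range f \<subseteq> QR \<epsilon> \<and> smooth_map A UNIV f \<and>
     (\<forall>p. \<forall>c\<in>charts_at A p. inj (dmap c f p) \<and>
        (\<forall>u v. amb \<epsilon> (dmap c f p u) (dmap c f p v) = g c p u v))"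

text \<open>The image of the tangent space at \<^term>\<open>p\<close> under the differential of \<^term>\<open>f\<close>.\<close>

definition push_space ::
  "('p, 'm::euclidean_space) chart set \<Rightarrow> ('p \<Rightarrow> (real \<times> 'n::euclidean_space) \<times> real)
     \<Rightarrow> 'p \<Rightarrow> ((real \<times> 'n) \<times> real) set" where
  "push_space A f p = (\<Union>c\<in>charts_at A p. range (dmap c f p))"

definition normal_fibre ::
  "real \<Rightarrow> ('p, 'm::euclidean_space) chart set \<Rightarrow> ('p \<Rightarrow> (real \<times> 'n::euclidean_space) \<times> real)
     \<Rightarrow> 'p \<Rightarrow> ((real \<times> 'n) \<times> real) set" where
  "normal_fibre \<epsilon> A f p =
     {w \<in> tangent_QR \<epsilon> (f p). \<forall>z\<in>push_space A f p. amb \<epsilon> w z = 0}"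

text \<open>The normal component of a vector \<open>w \<in> tangent_QR \<epsilon> (f p)\<close>.\<close>

definition normal_part ::
  "real \<Rightarrow> ('p, 'm::euclidean_space) chart set \<Rightarrow> ('p \<Rightarrow> (real \<times> 'n::euclidean_space) \<times> real)
     \<Rightarrow> 'p \<Rightarrow> (real \<times> 'n) \<times> real \<Rightarrow> (real \<times> 'n) \<times> real" where
  "normal_part \<epsilon> A f p w = (THE \<xi>. \<xi> \<in> normal_fibre \<epsilon> A f p \<and> w - \<xi> \<in> push_space A f p)"

text \<open>Covariant derivative in \<open>QR \<epsilon>\<close> of a vector field \<^term>\<open>\<xi>\<close> along \<^term>\<open>f\<close>, in the
  direction with components \<^term>\<open>u\<close> in the chart \<^term>\<open>c\<close>.\<close>

definition cov_deriv ::
  "real \<Rightarrow> ('p \<Rightarrow> (real \<times> 'n::euclidean_space) \<times> real) \<Rightarrow> ('p, 'm::euclidean_space) chart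
     \<Rightarrow> ('p \<Rightarrow> (real \<times> 'n) \<times> real) \<Rightarrow> 'p \<Rightarrow> 'm \<Rightarrow> (real \<times> 'n) \<times> real" where
  "cov_deriv \<epsilon> f c \<xi> p u = tan_proj \<epsilon> (f p) (dmap c \<xi> p u)"

text \<open>The second argument of the second fundamental form is extended to the field with constant
  components in the chart; by tensoriality the value does not depend on the extension.\<close>

definition second_ff ::
  "real \<Rightarrow> ('p, 'm::euclidean_space) chart set \<Rightarrow> ('p \<Rightarrow> (real \<times> 'n::euclidean_space) \<times> real)
     \<Rightarrow> ('p, 'm) chart \<Rightarrow> 'p \<Rightarrow> 'm \<Rightarrow> 'm \<Rightarrow> (real \<times> 'n) \<times> real" where
  "second_ff \<epsilon> A f c p u v = normal_part \<epsilon> A f p (cov_deriv \<epsilon> f c (\<lambda>q. dmap c f q v) p u)"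

definition normal_conn ::
  "real \<Rightarrow> ('p, 'm::euclidean_space) chart set \<Rightarrow> ('p \<Rightarrow> (real \<times> 'n::euclidean_space) \<times> real)
     \<Rightarrow> ('p, 'm) chart \<Rightarrow> ('p \<Rightarrow> (real \<times> 'n) \<times> real) \<Rightarrow> 'p \<Rightarrow> 'm \<Rightarrow> (real \<times> 'n) \<times> real" where
  "normal_conn \<epsilon> A f c \<xi> p u = normal_part \<epsilon> A f p (cov_deriv \<epsilon> f c \<xi> p u)"

definition first_normal_space ::
  "real \<Rightarrow> ('p, 'm::euclidean_space) chart set \<Rightarrow> ('p \<Rightarrow> (real \<times> 'n::euclidean_space) \<times> real)
     \<Rightarrow> 'p \<Rightarrow> ((real \<times> 'n) \<times> real) set" where
  "first_normal_space \<epsilon> A f p =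
     span {second_ff \<epsilon> A f c p u v | c u v. c \<in> charts_at A p}"

definition normal_subbundle ::
  "real \<Rightarrow> ('p::topological_space, 'm::euclidean_space) chart set
     \<Rightarrow> ('p \<Rightarrow> (real \<times> 'n::euclidean_space) \<times> real)
     \<Rightarrow> ('p \<Rightarrow> ((real \<times> 'n) \<times> real) set) \<Rightarrow> nat \<Rightarrow> bool" where
  "normal_subbundle \<epsilon> A f L l \<longleftrightarrow>
     (\<forall>p. L p \<subseteq> normal_fibre \<epsilon> A f p) \<and>
     (\<forall>p. \<exists>U E. open U \<and> p \<in> U \<and> (\<forall>i<l. smooth_map A U (E i)) \<and>
        (\<forall>q\<in>U. inj_on (\<lambda>i. E i q) {..<l} \<and> independent ((\<lambda>i. E i q) ` {..<l}) \<and>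
           span ((\<lambda>i. E i q) ` {..<l}) = L q))"

text \<open>The normal covariant derivatives of all local smooth sections of \<^term>\<open>N\<close> lie in
  \<^term>\<open>L\<close>.\<close>

definition normal_conn_maps_into ::
  "real \<Rightarrow> ('p::topological_space, 'm::euclidean_space) chart set
     \<Rightarrow> ('p \<Rightarrow> (real \<times> 'n::euclidean_space) \<times> real)
     \<Rightarrow> ('p \<Rightarrow> ((real \<times> 'n) \<times> real) set) \<Rightarrow> ('p \<Rightarrow> ((real \<times> 'n) \<times> real) set) \<Rightarrow> bool" where
  "normal_conn_maps_into \<epsilon> A f N L \<longleftrightarrow>
     (\<forall>U \<xi>. open U \<longrightarrow> smooth_map A U \<xi> \<longrightarrow> (\<forall>q\<in>U. \<xi> q \<in> N q) \<longrightarrow>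
        (\<forall>p\<in>U. \<forall>c\<in>charts_at A p. \<forall>u. normal_conn \<epsilon> A f c \<xi> p u \<in> L p))"


section \<open>Totally geodesic submanifolds\<close>

text \<open>\<open>P\<close> is the image of the standard model of dimension \<^term>\<open>k\<close>, with coordinates
  \<open>x 0, \<dots>, x k\<close>, under the linear isometric embedding of its ambient (Euclidean or Lorentzian)
  (k+1)-space that sends the standard basis to \<open>e 0, \<dots>, e k\<close>.\<close>

definition space_form_copy ::
  "real \<Rightarrow> nat \<Rightarrow> (real \<times> 'n::euclidean_space) set \<Rightarrow> bool" where
  "space_form_copy \<epsilon> k P \<longleftrightarrow> P \<subseteq> Q \<epsilon> \<and>
     (\<exists>e :: nat \<Rightarrow> real \<times> 'n.
        (\<forall>i\<le>k. \<forall>j\<le>k. form \<epsilon> (e i) (e j) = (if i \<noteq> j then 0 else if i = 0 then \<epsilon> else 1)) \<and>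
        P = {\<Sum>i\<le>k. x i *\<^sub>R e i | x :: nat \<Rightarrow> real.
               \<epsilon> * (x 0)\<^sup>2 + (\<Sum>i=1..k. (x i)\<^sup>2) = \<epsilon> \<and> (\<epsilon> = -1 \<longrightarrow> x 0 > 0)})"

text \<open>Velocities at \<^term>\<open>z\<close> of smooth curves in \<^term>\<open>S\<close>; for a submanifold, its tangent
  space.\<close>

definition velocities :: "'a::real_normed_vector set \<Rightarrow> 'a \<Rightarrow> 'a set" where
  "velocities S z = {w. \<exists>\<gamma> \<delta>::real. \<delta> > 0 \<and> smooth_on {-\<delta><..<\<delta>} \<gamma> \<and>
     \<gamma> ` {-\<delta><..<\<delta>} \<subseteq> S \<and> \<gamma> 0 = z \<and> (\<gamma> has_vector_derivative w) (at 0)}"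

text \<open>For a submanifold \<^term>\<open>S\<close>, vanishing of its second fundamental form in \<open>QR \<epsilon>\<close>: ambient
  covariant derivatives of tangent fields of \<^term>\<open>S\<close> along curves in \<^term>\<open>S\<close> are again tangent
  to \<^term>\<open>S\<close>.\<close>

definition totally_geodesic ::
  "real \<Rightarrow> ((real \<times> 'n::euclidean_space) \<times> real) set \<Rightarrow> bool" where
  "totally_geodesic \<epsilon> S \<longleftrightarrow> S \<subseteq> QR \<epsilon> \<and>
     (\<forall>a b \<gamma> Y. smooth_on {a<..<b::real} \<gamma> \<longrightarrow> smooth_on {a<..<b} Y \<longrightarrow>
        (\<forall>s\<in>{a<..<b}. \<gamma> s \<in> S \<and> Y s \<in> velocities S (\<gamma> s)) \<longrightarrow>
        (\<forall>s\<in>{a<..<b}. tan_proj \<epsilon> (\<gamma> s) (vector_derivative Y (at s)) \<in> velocities S (\<gamma> s)))"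

definition reduces_codimension_to ::
  "real \<Rightarrow> ('p, 'm::euclidean_space) chart set \<Rightarrow> ('p \<Rightarrow> (real \<times> 'n::euclidean_space) \<times> real)
     \<Rightarrow> nat \<Rightarrow> bool" where
  "reduces_codimension_to \<epsilon> A f l \<longleftrightarrow>
     (\<exists>P. space_form_copy \<epsilon> (DIM('m) + l - 1) P \<and> totally_geodesic \<epsilon> (P \<times> UNIV) \<and>
        range f \<subseteq> P \<times> UNIV)"

end

theory Submission
  imports Defs
begin

text \<open>At each point enlarge \<open>f\<^sub>*TM \<oplus> L\<close> by the position vector of the \<open>Q\<close>-factor, which is
  normal to \<open>Q \<epsilon> \<times> \<real>\<close> in the flat space.  The resulting bundle \<open>V\<close> of subspaces
  of the flat space is spanned by the sections \<open>f\<^sub>*X\<close>, \<open>\<alpha>(X,Y)\<close> (with \<open>\<alpha>\<close> the second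
  fundamental form), \<open>\<partial>/\<partial>t\<close> and the position vector;
  by the Gauss and Weingarten formulas and \<open>\<nabla>\<^sup>\<bottom>N\<^sub>1 \<subseteq> L\<close> their flat derivatives
  stay in \<open>V\<close>.  (A frame of the bundle need not restrict to one of \<open>N\<^sub>1\<close>, whose rank may vary,
  so the hypothesis is applied only to \<open>\<alpha>(X,Y)\<close>.)  Since \<open>V\<close> has constant rank and the manifold is
  connected, \<open>V\<close> is a constant subspace.  It contains \<open>\<partial>/\<partial>t\<close>, so it is a product
  \<open>W \<times> \<real>\<close>, and \<open>f\<close> takes its values in \<open>(W \<inter> Q \<epsilon>) \<times> \<real>\<close>.\<close>

section \<open>Calculus of smooth maps\<close>

text \<open>The line of \<open>\<eta>\<close> has to be in the bundle because of the position
  vector: its derivative along \<open>X\<close> is \<open>f_*X\<close> without the component along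
  \<open>dt\<close>, so it stays in the space only if \<open>dt\<close> does. No control on the
  normal derivatives of \<open>\<eta>\<close> is assumed; the constant field \<open>dt\<close>,
  whose flat derivative is zero, takes its place among the sections. Constancy of the subspace comes
  from an estimate rather than from parallel transport: sections through a basis at one point remain
  a frame nearby, and their pairings with a vector orthogonal to the initial space solve a linear
  system with zero initial data. Orthogonality is Euclidean here, as only the linear structure
  matters. The form, indefinite for \<open>\<epsilon> = -1\<close>, enters through its positivity on
  the tangent spaces of the quadric. This splits off normal components, and it gives the subspace,
  which contains a position vector, the signature of the model, so that the slice is a space form of
  the right type.\<close>

lemma Ck_on_Suc_has_derivative:
  "Ck_on (Suc k) S h \<Longrightarrow> x \<in> S \<Longrightarrow> (h has_derivative frechet_derivative h (at x)) (at x)"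
  by (simp add: frechet_derivative_works)

lemma Ck_on_Suc_imp: "Ck_on (Suc k) S h \<Longrightarrow> Ck_on k S h"
proof (induction k arbitrary: h)
  case 0
  then show ?case
    by (auto intro!: continuous_at_imp_continuous_on differentiable_imp_continuous_within)
qed (metis Ck_on.simps(2))

text \<open>Openness of \<open>S\<close> makes the two maps agree near each point, so their
  derivatives coincide there and the induction can pass to them.\<close>

lemma Ck_on_cong:
  assumes "open S" "\<And>x. x \<in> S \<Longrightarrow> h x = h' x" "Ck_on k S h"
  shows "Ck_on k S h'"
  using assms(2,3)
proof (induction k arbitrary: h h')
  case 0
  then show ?case using continuous_on_cong by (metis Ck_on.simps(1))
next
  case (Suc k)
  have D: "(h' has_derivative frechet_derivative h (at x)) (at x)" if "x \<in> S" for x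
    using has_derivative_transform_within_open[OF Ck_on_Suc_has_derivative[OF Suc.prems(2) that] assms(1) that]
      Suc.prems(1) by blast
  have "Ck_on k S (\<lambda>x. frechet_derivative h' (at x) v)" for v
    by (rule Suc.IH[of "\<lambda>x. frechet_derivative h (at x) v"])
      (use D frechet_derivative_at in \<open>fastforce\<close>, use Suc.prems(2) in simp)
  then show ?case using D by (auto simp: differentiable_def)
qed

text \<open>Lets the closure rules work with an explicit derivative formula instead of
  \<open>frechet_derivative\<close>.\<close>

lemma Ck_on_SucI:
  assumes "open S" "\<And>x. x \<in> S \<Longrightarrow> (h has_derivative D x) (at x)"
    and "\<And>v. Ck_on k S (\<lambda>x. D x v)"
  shows "Ck_on (Suc k) S h"
proof -
  have "Ck_on k S (\<lambda>x. frechet_derivative h (at x) v)" for v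
    by (rule Ck_on_cong[OF assms(1) _ assms(3)[of v]]) (use assms(2) frechet_derivative_at in fastforce)
  then show ?thesis using assms(2) by (auto simp: differentiable_def)
qed

lemma Ck_on_subset: "Ck_on k S h \<Longrightarrow> T \<subseteq> S \<Longrightarrow> Ck_on k T h"
  by (induction k arbitrary: h) (auto intro: continuous_on_subset)

lemma Ck_on_const: "Ck_on k S (\<lambda>x. a)"
  by (induction k arbitrary: a) auto

lemma Ck_on_add:
  assumes "open S" "Ck_on k S h1" "Ck_on k S h2"
  shows "Ck_on k S (\<lambda>x. h1 x + h2 x)"
  using assms(2,3)
proof (induction k arbitrary: h1 h2)
  case 0
  then show ?case by (auto intro: continuous_on_add)
next
  case (Suc k)
  show ?case
    by (rule Ck_on_SucI[OF assms(1) has_derivative_add[OF Ck_on_Suc_has_derivative[OF Suc.prems(1)]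
            Ck_on_Suc_has_derivative[OF Suc.prems(2)]]])
      (use Suc in auto)
qed

lemma Ck_on_bounded_bilinear:
  assumes "bounded_bilinear B" "open S" "Ck_on k S h1" "Ck_on k S h2"
  shows "Ck_on k S (\<lambda>x. B (h1 x) (h2 x))"
  using assms(3,4)
proof (induction k arbitrary: h1 h2)
  case 0
  then show ?case using bounded_bilinear.continuous_on[OF assms(1)] by auto
next
  case (Suc k)
  show ?case
    by (rule Ck_on_SucI[OF assms(2) bounded_bilinear.FDERIV[OF assms(1)
            Ck_on_Suc_has_derivative[OF Suc.prems(1)] Ck_on_Suc_has_derivative[OF Suc.prems(2)]]])
      (use Suc Ck_on_Suc_imp[OF Suc.prems(1)] Ck_on_Suc_imp[OF Suc.prems(2)] in
        \<open>auto intro!: Ck_on_add[OF assms(2)]\<close>)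
qed

lemma Ck_on_bounded_linear:
  assumes "bounded_linear B" "open S" "Ck_on k S h"
  shows "Ck_on k S (\<lambda>x. B (h x))"
  using assms(3)
proof (induction k arbitrary: h)
  case 0
  then show ?case using bounded_linear.continuous_on[OF assms(1)] by auto
next
  case (Suc k)
  show ?case
    by (rule Ck_on_SucI[OF assms(2) bounded_linear.has_derivative[OF assms(1)
            Ck_on_Suc_has_derivative[OF Suc.prems(1)]]])
      (use Suc in auto)
qed

lemma Ck_on_sum:
  assumes "open S" "finite I" "\<And>i. i \<in> I \<Longrightarrow> Ck_on k S (h i)"
  shows "Ck_on k S (\<lambda>x. \<Sum>i\<in>I. h i x)"
  using assms(2,3) by (induction I) (auto intro: Ck_on_const Ck_on_add[OF assms(1)])

text \<open>The derivative of \<open>1/h\<close> is a product of a derivative of \<open>h\<close>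
  with two copies of \<open>1/h\<close>, which is of class \<open>k\<close> by induction
  hypothesis.\<close>

lemma Ck_on_inverse:
  fixes h :: "'a::euclidean_space \<Rightarrow> real"
  assumes "open S" "\<And>x. x \<in> S \<Longrightarrow> h x \<noteq> 0" "Ck_on k S h"
  shows "Ck_on k S (\<lambda>x. inverse (h x))"
  using assms(3)
proof (induction k)
  case 0
  then show ?case using assms(2) by (auto intro: continuous_on_inverse)
next
  case (Suc k)
  show ?case
  proof (rule Ck_on_SucI[OF assms(1)])
    fix x assume x: "x \<in> S"
    show "(((\<lambda>x. inverse (h x))) has_derivative
       (\<lambda>v. (- 1) *\<^sub>R (inverse (h x) * frechet_derivative h (at x) v * inverse (h x)))) (at x)"
      using Deriv.has_derivative_inverse[OF assms(2)[OF x] Ck_on_Suc_has_derivative[OF Suc.prems x]] by simp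
  next
    fix v
    have "Ck_on k S (\<lambda>x. frechet_derivative h (at x) v)" "Ck_on k S (\<lambda>x. inverse (h x))"
      using Suc.prems Suc.IH[OF Ck_on_Suc_imp] by auto
    then show "Ck_on k S (\<lambda>x. (- 1) *\<^sub>R (inverse (h x) * frechet_derivative h (at x) v * inverse (h x)))"
      by (intro Ck_on_bounded_linear[OF bounded_linear_scaleR_right assms(1)]
          Ck_on_bounded_bilinear[OF bounded_bilinear_mult assms(1)])
  qed
qed

lemma Ck_on_compose:
  fixes h :: "'b::euclidean_space \<Rightarrow> 'c::real_normed_vector"
    and \<phi> :: "'a::euclidean_space \<Rightarrow> 'b"
  assumes "open S" "\<phi> ` S \<subseteq> R" "Ck_on k R h" "Ck_on k S \<phi>"
  shows "Ck_on k S (h \<circ> \<phi>)"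
  using assms(3,4)
proof (induction k arbitrary: h)
  case 0
  then show ?case using assms(2) by (metis Ck_on.simps(1) continuous_on_compose continuous_on_subset)
next
  case (Suc k)
  \<comment> \<open>\<open>Ck_on\<close> controls derivatives in fixed directions only, while the
    chain rule evaluates the derivative of \<open>h\<close> in a direction that moves with
    \<open>x\<close>. Expanding this direction in \<open>Basis\<close> leaves fixed directions with
    smooth coefficients.\<close>
  let ?D = "\<lambda>x v. \<Sum>b\<in>Basis. (frechet_derivative \<phi> (at x) v \<bullet> b) *\<^sub>R frechet_derivative h (at (\<phi> x)) b"
  show ?case
  proof (rule Ck_on_SucI[OF assms(1)])
    fix x assume x: "x \<in> S"
    have h: "(h has_derivative frechet_derivative h (at (\<phi> x))) (at (\<phi> x))"
      using Ck_on_Suc_has_derivative[OF Suc.prems(1)] x assms(2) by blast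
    have "frechet_derivative h (at (\<phi> x)) \<circ> frechet_derivative \<phi> (at x) = ?D x"
    proof
      fix v
      have lin: "linear (frechet_derivative h (at (\<phi> x)))"
        using h has_derivative_linear by blast
      have "frechet_derivative h (at (\<phi> x)) (frechet_derivative \<phi> (at x) v)
          = frechet_derivative h (at (\<phi> x)) (\<Sum>b\<in>Basis. (frechet_derivative \<phi> (at x) v \<bullet> b) *\<^sub>R b)"
        by (simp add: euclidean_representation)
      also have "\<dots> = ?D x v"
        by (simp add: linear_sum[OF lin] linear_scale[OF lin])
      finally show "(frechet_derivative h (at (\<phi> x)) \<circ> frechet_derivative \<phi> (at x)) v = ?D x v" by simp
    qed
    then show "((h \<circ> \<phi>) has_derivative ?D x) (at x)"
      using diff_chain_at[OF Ck_on_Suc_has_derivative[OF Suc.prems(2) x] h] by simp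
  next
    fix v
    have "Ck_on k S (\<lambda>x. frechet_derivative h (at (\<phi> x)) b)" for b
      using Suc.IH[of "\<lambda>y. frechet_derivative h (at y) b"] Suc.prems Ck_on_Suc_imp
      by (auto simp: o_def)
    then show "Ck_on k S (\<lambda>x. ?D x v)"
      using Suc.prems(2)
      by (intro Ck_on_sum[OF assms(1)] Ck_on_bounded_bilinear[OF bounded_bilinear_scaleR assms(1)]
          Ck_on_bounded_linear[OF bounded_linear_inner_left assms(1)]) auto
  qed
qed

section \<open>Closure rules for infinitely differentiable maps\<close>

lemma smooth_on_cong:
  "open S \<Longrightarrow> (\<And>x. x \<in> S \<Longrightarrow> h x = h' x) \<Longrightarrow> smooth_on S h \<Longrightarrow> smooth_on S h'"
  unfolding smooth_on_def using Ck_on_cong by blast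

lemma smooth_on_has_derivative:
  "smooth_on S h \<Longrightarrow> x \<in> S \<Longrightarrow> (h has_derivative frechet_derivative h (at x)) (at x)"
  using Ck_on_Suc_has_derivative unfolding smooth_on_def by blast

lemma smooth_on_differentiable: "smooth_on S h \<Longrightarrow> x \<in> S \<Longrightarrow> h differentiable at x"
  using smooth_on_has_derivative differentiable_def by blast

lemma smooth_on_frechet_derivative:
  "smooth_on S h \<Longrightarrow> smooth_on S (\<lambda>x. frechet_derivative h (at x) v)"
  unfolding smooth_on_def by (metis Ck_on.simps(2))

lemma smooth_on_imp_continuous_on: "smooth_on S h \<Longrightarrow> continuous_on S h"
  unfolding smooth_on_def by (metis Ck_on.simps(1))

lemma smooth_on_subset: "smooth_on S h \<Longrightarrow> R \<subseteq> S \<Longrightarrow> smooth_on R h"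
  using Ck_on_subset unfolding smooth_on_def by blast

lemma smooth_on_const: "smooth_on S (\<lambda>x. a)"
  by (simp add: smooth_on_def Ck_on_const)

lemma smooth_on_add:
  "open S \<Longrightarrow> smooth_on S h1 \<Longrightarrow> smooth_on S h2 \<Longrightarrow> smooth_on S (\<lambda>x. h1 x + h2 x)"
  by (simp add: smooth_on_def Ck_on_add)

lemma smooth_on_bounded_linear:
  "bounded_linear B \<Longrightarrow> open S \<Longrightarrow> smooth_on S h \<Longrightarrow> smooth_on S (\<lambda>x. B (h x))"
  by (simp add: smooth_on_def Ck_on_bounded_linear)

lemma smooth_on_bounded_bilinear:
  "bounded_bilinear B \<Longrightarrow> open S \<Longrightarrow> smooth_on S h1 \<Longrightarrow> smooth_on S h2
    \<Longrightarrow> smooth_on S (\<lambda>x. B (h1 x) (h2 x))"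
  by (simp add: smooth_on_def Ck_on_bounded_bilinear)

lemma smooth_on_diff:
  assumes "open S" "smooth_on S h1" "smooth_on S h2"
  shows "smooth_on S (\<lambda>x. h1 x - h2 x)"
  using smooth_on_add[OF assms(1,2) smooth_on_bounded_linear[OF bounded_linear_minus[OF bounded_linear_ident] assms(1,3)]]
  by simp

lemma smooth_on_inverse:
  fixes h :: "'a::euclidean_space \<Rightarrow> real"
  shows "open S \<Longrightarrow> (\<And>x. x \<in> S \<Longrightarrow> h x \<noteq> 0) \<Longrightarrow> smooth_on S h \<Longrightarrow> smooth_on S (\<lambda>x. inverse (h x))"
  by (simp add: smooth_on_def Ck_on_inverse)

lemma smooth_on_compose:
  fixes h :: "'b::euclidean_space \<Rightarrow> 'c::real_normed_vector"
    and \<phi> :: "'a::euclidean_space \<Rightarrow> 'b"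
  shows "open S \<Longrightarrow> \<phi> ` S \<subseteq> R \<Longrightarrow> smooth_on R h \<Longrightarrow> smooth_on S \<phi> \<Longrightarrow> smooth_on S (h \<circ> \<phi>)"
  by (simp add: smooth_on_def Ck_on_compose)

lemma smooth_on_ident: "open S \<Longrightarrow> smooth_on S (\<lambda>x. x)"
  unfolding smooth_on_def
proof
  fix k assume S: "open S"
  show "Ck_on k S (\<lambda>x. x)"
  proof (cases k)
    case (Suc j)
    show ?thesis unfolding Suc
      by (rule Ck_on_SucI[OF S has_derivative_ident]) (rule Ck_on_const)
  qed auto
qed

section \<open>Parallel distributions\<close>

text \<open>The coordinate functionals of the basis extend linearly to the whole space and are
  therefore bounded. This quantitative form of independence survives small perturbations of the
  vectors with an explicit constant.\<close>

lemma independent_coefficient_bound: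
  fixes B :: "'b::euclidean_space set"
  assumes "independent B"
  obtains K where "K > 0" "\<And>a. (\<Sum>v\<in>B. \<bar>a v\<bar>) \<le> K * norm (\<Sum>v\<in>B. a v *\<^sub>R v)"
proof -
  have fin: "finite B" using assms independent_imp_finite by blast
  have "\<exists>K>0. \<forall>a. \<bar>a v\<bar> \<le> K * norm (\<Sum>w\<in>B. a w *\<^sub>R w)" if v: "v \<in> B" for v
  proof -
    obtain g :: "'b \<Rightarrow> real" where g: "linear g" "\<forall>w\<in>B. g w = (if w = v then 1 else 0)"
      using linear_independent_extend[OF assms, of "\<lambda>w. if w = v then 1 else 0"] by blast
    obtain K where K: "K > 0" "\<And>x. norm (g x) \<le> K * norm x"
      using linear_bounded_pos[OF g(1)] by blast
    have "g (\<Sum>w\<in>B. a w *\<^sub>R w) = a v" for a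
    proof -
      have "g (\<Sum>w\<in>B. a w *\<^sub>R w) = (\<Sum>w\<in>B. a w * g w)"
        by (simp add: linear_sum[OF g(1)] linear_scale[OF g(1)])
      also have "\<dots> = (\<Sum>w\<in>B. if w = v then a w else 0)"
        by (rule sum.cong) (use g(2) in auto)
      also have "\<dots> = a v" using fin v by simp
      finally show ?thesis .
    qed
    then show ?thesis using K by (metis real_norm_def)
  qed
  then obtain K where K: "\<And>v. v \<in> B \<Longrightarrow> K v > 0"
    "\<And>v a. v \<in> B \<Longrightarrow> \<bar>a v\<bar> \<le> K v * norm (\<Sum>w\<in>B. a w *\<^sub>R w)"
    by metis
  show ?thesis
  proof
    \<comment> \<open>The summand \<open>1\<close> keeps the constant positive when \<open>B\<close>
      is empty.\<close>
    show "sum K B + 1 > 0" using K(1) by (simp add: add_nonneg_pos order_less_imp_le sum_nonneg)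
    fix a :: "'b \<Rightarrow> real"
    have "(\<Sum>v\<in>B. \<bar>a v\<bar>) \<le> (\<Sum>v\<in>B. K v * norm (\<Sum>w\<in>B. a w *\<^sub>R w))"
      by (rule sum_mono) (rule K(2))
    also have "\<dots> \<le> (sum K B + 1) * norm (\<Sum>v\<in>B. a v *\<^sub>R v)"
      by (simp add: sum_distrib_right[symmetric] distrib_right)
    finally show "(\<Sum>v\<in>B. \<bar>a v\<bar>) \<le> (sum K B + 1) * norm (\<Sum>v\<in>B. a v *\<^sub>R v)" .
  qed
qed

text \<open>Gronwall's argument: the factor \<open>exp (- C * t)\<close> turns the inequality into
  monotonicity.\<close>

lemma linear_differential_inequality:
  fixes \<psi> :: "real \<Rightarrow> real"
  assumes "\<And>t. t \<in> {0..1} \<Longrightarrow> (\<psi> has_real_derivative \<psi>' t) (at t)"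
    and "\<And>t. t \<in> {0..1} \<Longrightarrow> \<psi>' t \<le> C * \<psi> t"
    and "\<psi> 0 = 0"
  shows "\<psi> 1 \<le> 0"
proof -
  have "exp (- C * 1) * \<psi> 1 \<le> exp (- C * 0) * \<psi> 0"
  proof (rule DERIV_nonpos_imp_nonincreasing[where f = "\<lambda>t. exp (- C * t) * \<psi> t" and a = 0 and b = 1])
    fix t :: real assume "0 \<le> t" "t \<le> 1"
    then have t: "t \<in> {0..1}" by simp
    have "((\<lambda>t. exp (- C * t) * \<psi> t) has_real_derivative exp (- C * t) * (\<psi>' t - C * \<psi> t)) (at t)"
      by (auto intro!: derivative_eq_intros assms(1)[OF t] simp: algebra_simps)
    moreover have "exp (- C * t) * (\<psi>' t - C * \<psi> t) \<le> 0"
      using assms(2)[OF t] by (simp add: mult_le_0_iff)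
    ultimately show "\<exists>y. ((\<lambda>t. exp (- C * t) * \<psi> t) has_real_derivative y) (at t) \<and> y \<le> 0" by blast
  qed simp
  then show ?thesis using assms(3) by (simp add: mult_le_0_iff)
qed

text \<open>Fix \<open>z\<close> orthogonal to \<open>W\<close>. Along the segment from
  \<open>y0\<close> to \<open>y1\<close> the pairings of the frame with \<open>z\<close> satisfy a
  homogeneous linear system with zero initial values, hence vanish. The coefficients
  \<open>a\<close> may vary arbitrarily with the point: \<open>bd\<close> bounds them by the
  derivative of the frame, which is bounded on the segment.\<close>

lemma parallel_frame_stays_in_subspace:
  fixes G :: "'v \<Rightarrow> 'a::euclidean_space \<Rightarrow> 'b::euclidean_space"
  assumes "finite B" "open R" "convex R" "y0 \<in> R" "y1 \<in> R"
    and sm: "\<And>v. v \<in> B \<Longrightarrow> smooth_on R (G v)"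
    and par: "\<And>v y u. v \<in> B \<Longrightarrow> y \<in> R \<Longrightarrow> \<exists>a. frechet_derivative (G v) (at y) u = (\<Sum>w\<in>B. a w *\<^sub>R G w y)"
    and bd: "\<And>y a. y \<in> R \<Longrightarrow> (\<Sum>w\<in>B. \<bar>a w\<bar>) \<le> K * norm (\<Sum>w\<in>B. a w *\<^sub>R G w y)"
    and K: "K \<ge> 0"
    and W: "subspace W" "\<And>v. v \<in> B \<Longrightarrow> G v y0 \<in> W"
    and "v \<in> B"
  shows "G v y1 \<in> W"
proof -
  define \<sigma> where "\<sigma> t = y0 + t *\<^sub>R (y1 - y0)" for t :: real
  define h where "h v t = frechet_derivative (G v) (at (\<sigma> t)) (y1 - y0)" for v t
  have \<sigma>: "\<sigma> t \<in> R" if "t \<in> {0..1}" for t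
  proof -
    have "\<sigma> t = (1 - t) *\<^sub>R y0 + t *\<^sub>R y1" by (simp add: \<sigma>_def algebra_simps)
    then show ?thesis using that assms(3,4,5) by (auto intro: convexD_alt)
  qed
  have G': "((\<lambda>t. G v (\<sigma> t)) has_vector_derivative h v t) (at t)" if "t \<in> {0..1}" "v \<in> B" for t v
  proof -
    have "(\<sigma> has_derivative (\<lambda>s. s *\<^sub>R (y1 - y0))) (at t)"
      unfolding \<sigma>_def by (auto intro!: derivative_eq_intros)
    from diff_chain_at[OF this smooth_on_has_derivative[OF sm[OF that(2)] \<sigma>[OF that(1)]]]
    have "((\<lambda>t. G v (\<sigma> t)) has_derivative (\<lambda>s. frechet_derivative (G v) (at (\<sigma> t)) (s *\<^sub>R (y1 - y0)))) (at t)"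
      by (simp add: o_def)
    moreover have "linear (frechet_derivative (G v) (at (\<sigma> t)))"
      using smooth_on_has_derivative[OF sm[OF that(2)] \<sigma>[OF that(1)]] has_derivative_linear by blast
    ultimately show ?thesis unfolding has_vector_derivative_def h_def
      by (simp add: linear_scale)
  qed
  have "continuous_on {0..1} (h v)" if "v \<in> B" for v
  proof -
    have "continuous_on R (\<lambda>y. frechet_derivative (G v) (at y) (y1 - y0))"
      using smooth_on_imp_continuous_on[OF smooth_on_frechet_derivative[OF sm[OF that]]] .
    moreover have "continuous_on {0..1} \<sigma>"
      unfolding \<sigma>_def by (intro continuous_intros)
    ultimately show ?thesis
      unfolding h_def by (rule continuous_on_compose2) (use \<sigma> in auto)
  qed
  then have "continuous_on {0..1} (\<lambda>t. \<Sum>v\<in>B. norm (h v t))" by (intro continuous_intros)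
  then have "bounded ((\<lambda>t. \<Sum>v\<in>B. norm (h v t)) ` {0..1})"
    using compact_continuous_image compact_imp_bounded by blast
  then obtain M where M: "\<And>t. t \<in> {0..1} \<Longrightarrow> (\<Sum>v\<in>B. norm (h v t)) \<le> M"
    unfolding bounded_iff by (metis abs_le_D1 imageI real_norm_def)
  have hM: "norm (h v t) \<le> M" if "v \<in> B" "t \<in> {0..1}" for v t
    using member_le_sum[OF that(1), of "\<lambda>v. norm (h v t)"] assms(1) M[OF that(2)] by simp
  have "orthogonal z (G v y1)" if z: "z \<in> W\<^sup>\<bottom>" for z
  proof -
    define p where "p v t = z \<bullet> G v (\<sigma> t)" for v t
    define p' where "p' v t = z \<bullet> h v t" for v t
    have p': "(p v has_real_derivative p' v t) (at t)" if "t \<in> {0..1}" "v \<in> B" for t v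
      unfolding p_def p'_def has_real_derivative_iff_has_vector_derivative
      using bounded_linear.has_vector_derivative[OF bounded_linear_inner_right G'[OF that]] .
    \<comment> \<open>The derivative of one pairing involves all the others, so the estimate closes
      up only for the sum of their squares.\<close>
    define \<psi> where "\<psi> t = (\<Sum>v\<in>B. (p v t)\<^sup>2)" for t
    have p_le: "\<bar>p v t\<bar> \<le> sqrt (\<psi> t)" if "v \<in> B" for v t
    proof -
      have "(p v t)\<^sup>2 \<le> \<psi> t" unfolding \<psi>_def
        using that assms(1) by (intro member_le_sum) auto
      then show ?thesis using real_le_rsqrt by (metis power2_abs)
    qed
    have psi0: "\<psi> t \<ge> 0" for t unfolding \<psi>_def by (rule sum_nonneg) simp
    have p'_le: "\<bar>p' v t\<bar> \<le> K * M * sqrt (\<psi> t)" if t: "t \<in> {0..1}" and v: "v \<in> B" for v t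
    proof -
      obtain a where a: "h v t = (\<Sum>w\<in>B. a w *\<^sub>R G w (\<sigma> t))"
        using par[OF v \<sigma>[OF t]] unfolding h_def by blast
      have "p' v t = (\<Sum>w\<in>B. a w * p w t)"
        unfolding p'_def a p_def by (simp add: inner_sum_right)
      then have "\<bar>p' v t\<bar> \<le> (\<Sum>w\<in>B. \<bar>a w * p w t\<bar>)" by simp
      also have "\<dots> \<le> (\<Sum>w\<in>B. \<bar>a w\<bar> * sqrt (\<psi> t))"
        unfolding abs_mult by (intro sum_mono mult_left_mono p_le) auto
      also have "\<dots> = (\<Sum>w\<in>B. \<bar>a w\<bar>) * sqrt (\<psi> t)" by (simp add: sum_distrib_right)
      also have "(\<Sum>w\<in>B. \<bar>a w\<bar>) \<le> K * norm (h v t)" using bd[OF \<sigma>[OF t]] a by simp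
      also have "\<dots> \<le> K * M" using hM[OF v t] K by (simp add: mult_left_mono)
      finally show ?thesis using psi0 by (simp add: mult_right_mono)
    qed
    have "\<psi> 1 \<le> 0"
    proof (rule linear_differential_inequality)
      fix t :: real assume t: "t \<in> {0..1}"
      show "(\<psi> has_real_derivative (\<Sum>v\<in>B. 2 * p v t * p' v t)) (at t)"
        unfolding \<psi>_def using p'[OF t] by (auto intro!: derivative_eq_intros sum.cong)
      have "2 * p v t * p' v t \<le> 2 * K * M * \<psi> t" if v: "v \<in> B" for v
      proof -
        have "p v t * p' v t \<le> \<bar>p v t\<bar> * \<bar>p' v t\<bar>" by (simp add: abs_mult[symmetric])
        also have "\<dots> \<le> sqrt (\<psi> t) * (K * M * sqrt (\<psi> t))"
          using p_le[OF v] p'_le[OF t v] psi0 by (intro mult_mono) auto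
        also have "\<dots> = K * M * \<psi> t" using psi0 by simp
        finally show ?thesis by simp
      qed
      then have "(\<Sum>v\<in>B. 2 * p v t * p' v t) \<le> (\<Sum>v\<in>B. 2 * K * M * \<psi> t)" by (rule sum_mono)
      also have "\<dots> = (card B * 2 * K * M) * \<psi> t" by simp
      finally show "(\<Sum>v\<in>B. 2 * p v t * p' v t) \<le> (card B * 2 * K * M) * \<psi> t" .
    next
      have "p v 0 = 0" if "v \<in> B" for v
        using z W(2)[OF that] unfolding p_def \<sigma>_def orthogonal_comp_def orthogonal_def
        by (simp add: inner_commute[of z])
      then show "\<psi> 0 = 0" by (simp add: \<psi>_def)
    qed
    then have "\<bar>p v 1\<bar> \<le> 0" using p_le[OF \<open>v \<in> B\<close>, of 1] psi0[of 1] by simp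
    then show ?thesis by (simp add: p_def \<sigma>_def orthogonal_def)
  qed
  then have "G v y1 \<in> W\<^sup>\<bottom>\<^sup>\<bottom>" unfolding orthogonal_comp_def[of "W\<^sup>\<bottom>"]
    by (simp add: orthogonal_commute)
  then show ?thesis using orthogonal_comp_self[OF W(1)] by simp
qed

text \<open>Near \<^term>\<open>y0\<close>, sections through a basis of \<^term>\<open>W y0\<close> form a frame, which solves a
  linear ODE.\<close>

lemma parallel_distribution_locally_constant:
  fixes W :: "'a::euclidean_space \<Rightarrow> 'b::euclidean_space set"
  assumes "open S" "y0 \<in> S"
    and W: "\<And>y. y \<in> S \<Longrightarrow> subspace (W y)" "\<And>y. y \<in> S \<Longrightarrow> dim (W y) = N"
    and ext: "\<And>v. v \<in> W y0 \<Longrightarrow> \<exists>R G. open R \<and> y0 \<in> R \<and> smooth_on R G \<and> G y0 = v \<and>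
        (\<forall>y\<in>R. G y \<in> W y \<and> (\<forall>u. frechet_derivative G (at y) u \<in> W y))"
  obtains r where "r > 0" "ball y0 r \<subseteq> S" "\<And>y. y \<in> ball y0 r \<Longrightarrow> W y = W y0"
proof -
  obtain B where B: "B \<subseteq> W y0" "independent B" "W y0 \<subseteq> span B" "card B = dim (W y0)"
    using basis_exists by blast
  have fin: "finite B" using B(2) independent_imp_finite by blast
  have spanB: "span B = W y0"
    using B(1,3) W(1)[OF assms(2)] by (simp add: span_minimal subset_antisym)
  \<comment> \<open>One predicate for the whole extension property, so that a single choice yields
    the domain and the section together.\<close>
  define ext_by where "ext_by v R G \<longleftrightarrow> open R \<and> y0 \<in> R \<and> smooth_on R G \<and> G y0 = v \<and>
      (\<forall>y\<in>R. G y \<in> W y \<and> (\<forall>u. frechet_derivative G (at y) u \<in> W y))" for v R G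
  have "\<forall>v\<in>B. \<exists>p. ext_by v (fst p) (snd p)"
  proof
    fix v assume "v \<in> B"
    then have "\<exists>R G. ext_by v R G" unfolding ext_by_def using B(1) by (intro ext) auto
    then show "\<exists>p. ext_by v (fst p) (snd p)" by (metis fst_conv snd_conv)
  qed
  from bchoice[OF this] obtain p where p: "\<And>v. v \<in> B \<Longrightarrow> ext_by v (fst (p v)) (snd (p v))"
    by blast
  define R where "R v = fst (p v)" for v
  define G where "G v = snd (p v)" for v
  have RG: "open (R v)" "y0 \<in> R v" "smooth_on (R v) (G v)" "G v y0 = v"
    "y \<in> R v \<Longrightarrow> G v y \<in> W y" "y \<in> R v \<Longrightarrow> frechet_derivative (G v) (at y) u \<in> W y"
    if "v \<in> B" for v y u
    using p[OF that] unfolding ext_by_def R_def G_def by auto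
  obtain K where K: "K > 0" "\<And>a. (\<Sum>v\<in>B. \<bar>a v\<bar>) \<le> K * norm (\<Sum>v\<in>B. a v *\<^sub>R v)"
    using independent_coefficient_bound[OF B(2)] by blast
  define S' where "S' = S \<inter> (\<Inter>v\<in>B. R v)"
  have "open S'" unfolding S'_def using fin RG(1) assms(1) by auto
  \<comment> \<open>Moving each basis vector by less than \<open>1 / (2 * K)\<close> costs at most
    half of the coefficient sum in the bound with \<open>K\<close>, so the bound persists with
    \<open>2 * K\<close>.\<close>
  have "eventually (\<lambda>y. y \<in> S' \<and> (\<forall>v\<in>B. dist (G v y) v < 1 / (2 * K))) (nhds y0)"
  proof (intro eventually_conj eventually_ball_finite[OF fin] ballI)
    show "eventually (\<lambda>y. y \<in> S') (nhds y0)"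
      using \<open>open S'\<close> RG(2) assms(2) by (auto simp: S'_def eventually_nhds)
    fix v assume v: "v \<in> B"
    have "isCont (G v) y0"
      using smooth_on_imp_continuous_on[OF RG(3)[OF v]] RG(1,2)[OF v] continuous_on_eq_continuous_at by blast
    then have "filterlim (G v) (nhds v) (nhds y0)"
      using RG(4)[OF v] by (metis continuous_at tendsto_at_iff_tendsto_nhds)
    then show "eventually (\<lambda>y. dist (G v y) v < 1 / (2 * K)) (nhds y0)"
      using K(1) tendstoD by fastforce
  qed
  then obtain r where r: "r > 0" "\<And>y. dist y y0 < r \<Longrightarrow> y \<in> S'"
    "\<And>y v. dist y y0 < r \<Longrightarrow> v \<in> B \<Longrightarrow> dist (G v y) v < 1 / (2 * K)"
    unfolding eventually_nhds_metric by blast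
  let ?U = "ball y0 r"
  have U: "y \<in> S'" "y \<in> S" "v \<in> B \<Longrightarrow> y \<in> R v" if "y \<in> ?U" for y v
    using r(2)[of y] that by (auto simp: dist_commute S'_def)
  have bd: "(\<Sum>v\<in>B. \<bar>a v\<bar>) \<le> 2 * K * norm (\<Sum>v\<in>B. a v *\<^sub>R G v y)" if y: "y \<in> ?U" for a y
  proof -
    have "norm (\<Sum>v\<in>B. a v *\<^sub>R v) \<le> norm (\<Sum>v\<in>B. a v *\<^sub>R G v y) + norm (\<Sum>v\<in>B. a v *\<^sub>R (G v y - v))"
      using norm_triangle_ineq4[of "\<Sum>v\<in>B. a v *\<^sub>R G v y" "\<Sum>v\<in>B. a v *\<^sub>R (G v y - v)"]
      by (simp add: scaleR_diff_right sum_subtractf)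
    also have "norm (\<Sum>v\<in>B. a v *\<^sub>R (G v y - v)) \<le> (\<Sum>v\<in>B. \<bar>a v\<bar> * (1 / (2 * K)))"
    proof (rule order_trans[OF norm_sum sum_mono])
      fix v assume "v \<in> B"
      then have "norm (G v y - v) \<le> 1 / (2 * K)"
        using r(3)[of y v] y by (auto simp: dist_commute dist_norm[symmetric])
      then show "norm (a v *\<^sub>R (G v y - v)) \<le> \<bar>a v\<bar> * (1 / (2 * K))"
        by (simp only: norm_scaleR mult_left_mono abs_ge_zero)
    qed
    finally have "norm (\<Sum>v\<in>B. a v *\<^sub>R v) \<le> norm (\<Sum>v\<in>B. a v *\<^sub>R G v y) + (\<Sum>v\<in>B. \<bar>a v\<bar>) / (2 * K)"
      by (simp add: sum_divide_distrib)
    then have "K * norm (\<Sum>v\<in>B. a v *\<^sub>R v)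
        \<le> K * (norm (\<Sum>v\<in>B. a v *\<^sub>R G v y) + (\<Sum>v\<in>B. \<bar>a v\<bar>) / (2 * K))"
      using K(1) by (intro mult_left_mono) auto
    also have "\<dots> = K * norm (\<Sum>v\<in>B. a v *\<^sub>R G v y) + (\<Sum>v\<in>B. \<bar>a v\<bar>) / 2"
      using K(1) by (simp add: distrib_left)
    finally show ?thesis using K(2)[of a] by linarith
  qed
  have frame: "W y = {\<Sum>v\<in>B. a v *\<^sub>R G v y | a. True}" if y: "y \<in> ?U" for y
  proof -
    \<comment> \<open>\<open>\<Phi>\<close> carries the basis at \<open>y0\<close> to the sections
      at \<open>y\<close>. The bound makes it injective, and the constant rank then makes its image
      all of \<open>W y\<close>.\<close>
    obtain \<Phi> where \<Phi>: "linear \<Phi>" "\<forall>v\<in>B. \<Phi> v = G v y"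
      using linear_independent_extend[OF B(2), of "\<lambda>v. G v y"] by blast
    have \<Phi>_sum: "\<Phi> (\<Sum>v\<in>B. a v *\<^sub>R v) = (\<Sum>v\<in>B. a v *\<^sub>R G v y)" for a
      using \<Phi>(2) by (simp add: linear_sum[OF \<Phi>(1)] linear_scale[OF \<Phi>(1)])
    have spB: "span B = {\<Sum>v\<in>B. a v *\<^sub>R v | a. True}" using span_finite[OF fin] by auto
    have "inj_on \<Phi> (span B)"
    proof (subst linear_injective_on_subspace_0[OF \<Phi>(1) subspace_span], intro ballI impI)
      fix x assume "x \<in> span B" "\<Phi> x = 0"
      then obtain a where a: "x = (\<Sum>v\<in>B. a v *\<^sub>R v)" unfolding spB by blast
      then have "(\<Sum>v\<in>B. \<bar>a v\<bar>) \<le> 0" using bd[OF y, of a] \<Phi>_sum \<open>\<Phi> x = 0\<close> by simp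
      then have "\<forall>v\<in>B. a v = 0"
        using sum_nonneg_eq_0_iff[OF fin, of "\<lambda>v. \<bar>a v\<bar>"] sum_nonneg[of B "\<lambda>v. \<bar>a v\<bar>"]
        by (metis abs_ge_zero abs_zero abs_eq_0 order_antisym)
      then show "x = 0" using a by simp
    qed
    then have "dim (\<Phi> ` W y0) = N"
      using dim_image_eq[OF \<Phi>(1), of B] W(2)[OF assms(2)] spanB by (metis linear_span_image dim_span \<Phi>(1))
    moreover have sub: "\<Phi> ` W y0 \<subseteq> W y"
    proof -
      have "\<Phi> ` B \<subseteq> W y" using \<Phi>(2) RG(5) U(3)[OF y] by auto
      then have "span (\<Phi> ` B) \<subseteq> W y" using W(1)[OF U(2)[OF y]] by (rule span_minimal)
      then show ?thesis using linear_span_image[OF \<Phi>(1), of B] spanB by simp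
    qed
    ultimately have "\<Phi> ` W y0 = W y"
      using subspace_dim_equal[OF linear_subspace_image[OF \<Phi>(1) W(1)[OF assms(2)]] W(1)[OF U(2)[OF y]] sub]
        W(2)[OF U(2)[OF y]] by simp
    then have "W y = \<Phi> ` {\<Sum>v\<in>B. a v *\<^sub>R v | a. True}" unfolding spanB[symmetric] spB by simp
    also have "\<dots> = {\<Phi> (\<Sum>v\<in>B. a v *\<^sub>R v) | a. True}" by blast
    finally show ?thesis unfolding \<Phi>_sum .
  qed
  show ?thesis
  proof
    show "r > 0" by (rule r(1))
    show "?U \<subseteq> S" using U(2) by blast
    fix y assume y: "y \<in> ?U"
    have "G v y \<in> W y0" if "v \<in> B" for v
    proof (rule parallel_frame_stays_in_subspace[where B = B and R = ?U and ?y0.0 = y0 and G = G and K = "2 * K"])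
      show "smooth_on ?U (G v)" if "v \<in> B" for v
        using smooth_on_subset[OF RG(3)[OF that]] U(3)[OF _ that] by blast
      show "\<exists>a. frechet_derivative (G v) (at y) u = (\<Sum>w\<in>B. a w *\<^sub>R G w y)"
        if "v \<in> B" "y \<in> ?U" for v y u
        using RG(6)[OF that(1) U(3)[OF that(2,1)], of u] frame[OF that(2)] by blast
      show "G v y0 \<in> W y0" if "v \<in> B" for v using RG(4)[OF that] B(1) that by auto
    qed (use fin y r(1) K(1) bd W(1)[OF assms(2)] that in auto)
    then have "(\<Sum>v\<in>B. a v *\<^sub>R G v y) \<in> W y0" for a
      using W(1)[OF assms(2)] by (intro subspace_sum subspace_scale)
    then have "W y \<subseteq> W y0" unfolding frame[OF y] by blast
    then show "W y = W y0"
      using subspace_dim_equal[OF W(1)[OF U(2)[OF y]] W(1)[OF assms(2)]] W(2)[OF U(2)[OF y]] W(2)[OF assms(2)]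
      by simp
  qed
qed

text \<open>Despite the name, \<open>F\<close> is not covariantly constant: its flat derivatives are
  only required to remain in \<open>V\<close>. They are tested in every chart around the point, so
  that the condition involves no choice of chart.\<close>

definition parallel_section ::
  "('p::topological_space, 'm::euclidean_space) chart set \<Rightarrow> ('p \<Rightarrow> 'b::real_normed_vector set)
     \<Rightarrow> 'p set \<Rightarrow> ('p \<Rightarrow> 'b) \<Rightarrow> bool" where
  "parallel_section A V U F \<longleftrightarrow> open U \<and> smooth_map A U F \<and>
     (\<forall>q\<in>U. F q \<in> V q \<and> (\<forall>c\<in>charts_at A q. \<forall>u. dmap c F q u \<in> V q))"

section \<open>Derivatives in charts, and sections whose derivatives stay in the bundle\<close>

context
  fixes A :: "('p::{t2_space, second_countable_topology}, 'm::euclidean_space) chart set"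
  assumes atlas: "smooth_atlas A"
begin

lemma charts_at_nonempty: "\<exists>c. c \<in> charts_at A p"
  using atlas unfolding smooth_atlas_def charts_at_def by blast

lemma chart_homeomorphism:
  assumes "c \<in> A"
  shows "open (fst c)" "open (snd c ` fst c)" "homeomorphism (fst c) (snd c ` fst c) (snd c) (param c)"
  using atlas assms unfolding smooth_atlas_def by auto

lemma param_chart: "c \<in> A \<Longrightarrow> q \<in> fst c \<Longrightarrow> param c (snd c q) = q"
  using chart_homeomorphism(3) homeomorphism_apply1 by blast

lemma open_chart_image:
  assumes "c \<in> A" "open U"
  shows "open (snd c ` (fst c \<inter> U))"
proof -
  have "snd c ` (fst c \<inter> U) = snd c ` fst c \<inter> param c -` U"
    using param_chart[OF assms(1)] by force
  moreover have "continuous_on (snd c ` fst c) (param c)"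
    using chart_homeomorphism(3)[OF assms(1)] by (simp add: homeomorphism_def)
  ultimately show ?thesis
    using continuous_open_preimage[OF _ chart_homeomorphism(2)[OF assms(1)] assms(2)] by simp
qed

text \<open>The other charts are reached by composition with the smooth transition maps.\<close>

lemma smooth_map_chartI:
  fixes F :: "'p \<Rightarrow> 'b::real_normed_vector"
  assumes "c \<in> A" "open U" "U \<subseteq> fst c" "smooth_on (snd c ` U) (F \<circ> param c)"
  shows "smooth_map A U F"
  unfolding smooth_map_def
proof
  fix d assume d: "d \<in> A"
  let ?S = "snd d ` (fst d \<inter> U)"
  have "smooth_on (snd d ` (fst d \<inter> fst c)) (snd c \<circ> param d)"
    using atlas assms(1) d unfolding smooth_atlas_def by blast
  then have "smooth_on ?S (snd c \<circ> param d)"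
    by (rule smooth_on_subset) (use assms(3) in blast)
  moreover have "(snd c \<circ> param d) ` ?S \<subseteq> snd c ` U"
    using param_chart[OF d] by auto
  ultimately have "smooth_on ?S ((F \<circ> param c) \<circ> (snd c \<circ> param d))"
    by (intro smooth_on_compose[OF open_chart_image[OF d assms(2)] _ assms(4)])
  then show "smooth_on ?S (F \<circ> param d)"
    by (rule smooth_on_cong[OF open_chart_image[OF d assms(2)], rotated])
      (use param_chart[OF d] param_chart[OF assms(1)] assms(3) in auto)
qed

lemma smooth_map_subset: "smooth_map A U F \<Longrightarrow> U' \<subseteq> U \<Longrightarrow> smooth_map A U' F"
  unfolding smooth_map_def by (meson Int_mono image_mono smooth_on_subset subset_refl)

lemma dmap_has_derivative:
  assumes "smooth_map A U F" "q \<in> U" "c \<in> charts_at A q"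
  shows "((F \<circ> param c) has_derivative dmap c F q) (at (snd c q))"
proof -
  have "smooth_on (snd c ` (fst c \<inter> U)) (F \<circ> param c)" "snd c q \<in> snd c ` (fst c \<inter> U)"
    using assms unfolding smooth_map_def charts_at_def by auto
  from smooth_on_has_derivative[OF this] show ?thesis
    by (simp add: dmap_def[abs_def])
qed

lemma dmap_eqI:
  assumes "((F \<circ> param c) has_derivative D) (at (snd c q))"
  shows "dmap c F q u = D u"
  using frechet_derivative_at[OF assms] by (simp add: dmap_def)

lemma dmap_linear:
  assumes "smooth_map A U F" "q \<in> U" "c \<in> charts_at A q"
  shows "linear (dmap c F q)"
  using dmap_has_derivative[OF assms] has_derivative_linear by blast

text \<open>Chain rule through the transition map: \<open>dmap d (snd c) q u\<close> gives the
  components in \<open>c\<close> of the vector with components \<open>u\<close> in \<open>d\<close>.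
  A condition on derivatives in all charts thereby reduces to one convenient chart.\<close>

lemma dmap_chart_change:
  assumes F: "smooth_map A U F" "q \<in> U" and cd: "c \<in> charts_at A q" "d \<in> charts_at A q"
  shows "dmap d F q u = dmap c F q (dmap d (snd c) q u)"
proof -
  have cA: "c \<in> A" "d \<in> A" "q \<in> fst c" "q \<in> fst d" using cd by (auto simp: charts_at_def)
  let ?S = "snd d ` (fst d \<inter> fst c)"
  have "smooth_on ?S (snd c \<circ> param d)"
    using atlas cA unfolding smooth_atlas_def by blast
  moreover have S: "snd d q \<in> ?S" using cA by blast
  ultimately have "((snd c \<circ> param d) has_derivative dmap d (snd c) q) (at (snd d q))"
    unfolding dmap_def[abs_def] by (rule smooth_on_has_derivative)
  moreover have "((F \<circ> param c) has_derivative dmap c F q) (at ((snd c \<circ> param d) (snd d q)))"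
    using dmap_has_derivative[OF F cd(1)] param_chart cA by simp
  ultimately have "((F \<circ> param c) \<circ> (snd c \<circ> param d) has_derivative dmap c F q \<circ> dmap d (snd c) q) (at (snd d q))"
    by (rule diff_chain_at)
  then have "((F \<circ> param d) has_derivative dmap c F q \<circ> dmap d (snd c) q) (at (snd d q))"
    by (rule has_derivative_transform_within_open[OF _ open_chart_image[OF cA(2) chart_homeomorphism(1)[OF cA(1)]] S])
      (use param_chart[OF cA(1)] param_chart[OF cA(2)] in auto)
  from dmap_eqI[OF this] show ?thesis by simp
qed

lemma parallel_section_const:
  assumes "\<And>q. a \<in> V q" "\<And>q. subspace (V q)"
  shows "parallel_section A V UNIV (\<lambda>q. a)"
proof -
  have "dmap c (\<lambda>q. a) q u = 0" for c :: "('p, 'm) chart" and q u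
    by (rule dmap_eqI[where D = "\<lambda>x. 0"]) (simp add: o_def)
  then show ?thesis
    using assms by (auto simp: parallel_section_def smooth_map_def smooth_on_const o_def subspace_0)
qed

lemma parallel_section_add:
  assumes F: "parallel_section A V U F" and G: "parallel_section A V U' G" and V: "\<And>q. subspace (V q)"
  shows "parallel_section A V (U \<inter> U') (\<lambda>q. F q + G q)"
proof -
  have op: "open (U \<inter> U')" using F G unfolding parallel_section_def by auto
  have sm: "smooth_map A (U \<inter> U') F" "smooth_map A (U \<inter> U') G"
    using F G unfolding parallel_section_def by (auto intro: smooth_map_subset)
  have "smooth_map A (U \<inter> U') (\<lambda>q. F q + G q)"
    unfolding smooth_map_def
  proof
    fix c assume c: "c \<in> A"
    show "smooth_on (snd c ` (fst c \<inter> (U \<inter> U'))) ((\<lambda>q. F q + G q) \<circ> param c)"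
      using smooth_on_add[OF open_chart_image[OF c op]] sm c unfolding smooth_map_def o_def by blast
  qed
  moreover have "dmap c (\<lambda>q. F q + G q) q u = dmap c F q u + dmap c G q u"
    if "q \<in> U \<inter> U'" "c \<in> charts_at A q" for q c u
    using has_derivative_add[OF dmap_has_derivative[OF sm(1) that] dmap_has_derivative[OF sm(2) that]]
    by (intro dmap_eqI) (simp add: o_def)
  ultimately show ?thesis
    using op F G V unfolding parallel_section_def by (auto intro: subspace_add)
qed

lemma parallel_section_scaleR:
  assumes F: "parallel_section A V U F" and V: "\<And>q. subspace (V q)"
  shows "parallel_section A V U (\<lambda>q. a *\<^sub>R F q)"
proof -
  have op: "open U" and sm: "smooth_map A U F"
    using F unfolding parallel_section_def by auto
  have "smooth_map A U (\<lambda>q. a *\<^sub>R F q)"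
    unfolding smooth_map_def
  proof
    fix c assume c: "c \<in> A"
    show "smooth_on (snd c ` (fst c \<inter> U)) ((\<lambda>q. a *\<^sub>R F q) \<circ> param c)"
      using smooth_on_bounded_linear[OF bounded_linear_scaleR_right open_chart_image[OF c op]] sm c
      unfolding smooth_map_def o_def by blast
  qed
  moreover have "dmap c (\<lambda>q. a *\<^sub>R F q) q u = a *\<^sub>R dmap c F q u"
    if "q \<in> U" "c \<in> charts_at A q" for q c u
    using has_derivative_scaleR_right[OF dmap_has_derivative[OF sm that], of a]
    by (intro dmap_eqI) (simp add: o_def)
  ultimately show ?thesis
    using op F V unfolding parallel_section_def by (auto intro: subspace_scale)
qed

text \<open>Sections live on different domains, so the linear structure is put on their values at
  the fixed point \<open>p\<close>. The extension property then has to be checked only on a spanning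
  set of \<open>V p\<close>.\<close>

lemma subspace_parallel_values:
  assumes "\<And>q. subspace (V q)"
  shows "subspace {F p | F U. p \<in> U \<and> parallel_section A V U F}"
proof (rule subspaceI)
  show "0 \<in> {F p | F U. p \<in> U \<and> parallel_section A V U F}"
    using parallel_section_const[of 0 V] assms
    by (intro CollectI exI[of _ "\<lambda>q. 0"] exI[of _ UNIV]) (auto intro: subspace_0)
next
  fix x y assume "x \<in> {F p | F U. p \<in> U \<and> parallel_section A V U F}"
    "y \<in> {F p | F U. p \<in> U \<and> parallel_section A V U F}"
  then obtain F U G U' where "x = F p" "p \<in> U" "parallel_section A V U F"
    "y = G p" "p \<in> U'" "parallel_section A V U' G" by blast
  then show "x + y \<in> {F p | F U. p \<in> U \<and> parallel_section A V U F}"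
    using parallel_section_add[of V U F U' G] assms
    by (intro CollectI exI[of _ "\<lambda>q. F q + G q"] exI[of _ "U \<inter> U'"]) auto
next
  fix a :: real and x assume "x \<in> {F p | F U. p \<in> U \<and> parallel_section A V U F}"
  then obtain F U where "x = F p" "p \<in> U" "parallel_section A V U F" by blast
  then show "a *\<^sub>R x \<in> {F p | F U. p \<in> U \<and> parallel_section A V U F}"
    using parallel_section_scaleR[of V U F a] assms
    by (intro CollectI exI[of _ "\<lambda>q. a *\<^sub>R F q"] exI[of _ U]) auto
qed

text \<open>In a chart, the coordinate representatives of the sections supply the extensions that
  the local result asks for; a locally constant map on a connected space is constant.\<close>

lemma parallel_distribution_constant:
  fixes V :: "'p \<Rightarrow> 'b::euclidean_space set"
  assumes conn: "connected (UNIV :: 'p set)"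
    and V: "\<And>p. subspace (V p)" "\<And>p. dim (V p) = N"
    and ext: "\<And>p. V p \<subseteq> {F p | F U. p \<in> U \<and> parallel_section A V U F}"
  shows "V p = V q"
proof (rule connected_local_const[OF conn UNIV_I UNIV_I], rule ballI)
  fix p
  obtain c where c: "c \<in> charts_at A p" using charts_at_nonempty by blast
  then have cA: "c \<in> A" "p \<in> fst c" by (auto simp: charts_at_def)
  let ?W = "\<lambda>y. V (param c y)"
  have "\<exists>R G. open R \<and> snd c p \<in> R \<and> smooth_on R G \<and> G (snd c p) = v \<and>
        (\<forall>y\<in>R. G y \<in> ?W y \<and> (\<forall>u. frechet_derivative G (at y) u \<in> ?W y))"
    if v: "v \<in> ?W (snd c p)" for v
  proof -
    obtain F U where F: "F p = v" "p \<in> U" "parallel_section A V U F"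
      using ext[of p] v param_chart[OF cA] by auto
    have "F q \<in> V q \<and> (\<forall>u. frechet_derivative (F \<circ> param c) (at (snd c q)) u \<in> V q)"
      if "q \<in> fst c \<inter> U" for q
    proof -
      have "c \<in> charts_at A q" using that cA by (simp add: charts_at_def)
      then show ?thesis using F(3) that unfolding parallel_section_def dmap_def by blast
    qed
    then show ?thesis
      using F cA param_chart[OF cA(1)] open_chart_image[OF cA(1), of U]
      unfolding parallel_section_def smooth_map_def
      by (intro exI[of _ "snd c ` (fst c \<inter> U)"] exI[of _ "F \<circ> param c"]) auto
  qed
  with chart_homeomorphism(2)[OF cA(1)] cA(2) V
  obtain r where r: "r > 0" "ball (snd c p) r \<subseteq> snd c ` fst c"
    "\<And>y. y \<in> ball (snd c p) r \<Longrightarrow> ?W y = ?W (snd c p)"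
    using parallel_distribution_locally_constant[of "snd c ` fst c" "snd c p" ?W N] by blast
  let ?O = "fst c \<inter> snd c -` ball (snd c p) r"
  have "continuous_on (fst c) (snd c)"
    using chart_homeomorphism(3)[OF cA(1)] by (simp add: homeomorphism_def)
  then have "open ?O" using chart_homeomorphism(1)[OF cA(1)] continuous_open_preimage by blast
  moreover have "p \<in> ?O" using cA r(1) by simp
  moreover have "V p = V q" if "q \<in> ?O" for q
    using r(3)[of "snd c q"] that param_chart[OF cA(1)] cA(2) by auto
  ultimately show "eventually (\<lambda>q. V p = V q) (at p within UNIV)"
    unfolding eventually_at_topological by blast
qed

end

section \<open>Linear slices of the ambient space\<close>

lemma bounded_bilinear_form: "bounded_bilinear (form \<epsilon>)"
  unfolding bilinear_conv_bounded_bilinear[symmetric] bilinear_def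
  by (auto intro!: linearI simp: form_def algebra_simps inner_simps)

lemma bounded_bilinear_amb: "bounded_bilinear (amb \<epsilon>)"
  unfolding bilinear_conv_bounded_bilinear[symmetric] bilinear_def
  by (auto intro!: linearI simp: amb_def form_def algebra_simps inner_simps)

lemmas form_simps = bounded_bilinear.add_left[OF bounded_bilinear_form]
  bounded_bilinear.add_right[OF bounded_bilinear_form]
  bounded_bilinear.diff_left[OF bounded_bilinear_form]
  bounded_bilinear.diff_right[OF bounded_bilinear_form]
  bounded_bilinear.scaleR_left[OF bounded_bilinear_form]
  bounded_bilinear.scaleR_right[OF bounded_bilinear_form]
  bounded_bilinear.sum_left[OF bounded_bilinear_form]
  bounded_bilinear.sum_right[OF bounded_bilinear_form]
  bounded_bilinear.zero_left[OF bounded_bilinear_form]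
  bounded_bilinear.zero_right[OF bounded_bilinear_form]

lemmas amb_simps = bounded_bilinear.add_left[OF bounded_bilinear_amb]
  bounded_bilinear.diff_left[OF bounded_bilinear_amb]
  bounded_bilinear.scaleR_left[OF bounded_bilinear_amb]
  bounded_bilinear.zero_left[OF bounded_bilinear_amb]
  bounded_bilinear.zero_right[OF bounded_bilinear_amb]
  bounded_bilinear.add_right[OF bounded_bilinear_amb]
  bounded_bilinear.scaleR_right[OF bounded_bilinear_amb]

lemma form_commute: "form \<epsilon> x y = form \<epsilon> y x"
  by (simp add: form_def inner_commute)

section \<open>Positivity of the form on tangent spaces, and the choice of the sheet\<close>

lemma hyperboloid_norms:
  assumes "z \<in> Q (-1)"
  shows "norm (snd z) < fst z" "(fst z)\<^sup>2 = 1 + (norm (snd z))\<^sup>2"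
proof -
  show sq: "(fst z)\<^sup>2 = 1 + (norm (snd z))\<^sup>2"
    using assms by (simp add: Q_def form_def power2_norm_eq_inner power2_eq_square[of "fst z"])
  show "norm (snd z) < fst z"
    by (rule power2_less_imp_less) (use sq assms in \<open>auto simp: Q_def\<close>)
qed

text \<open>For \<open>\<epsilon> = -1\<close> the vector \<open>z\<close> is timelike, and the
  Cauchy-Schwarz inequality in the spatial part forces a nonzero vector orthogonal to it to be
  spacelike. The later positivity arguments in the indefinite flat space rest on this.\<close>

lemma form_tangent_pos:
  assumes \<epsilon>: "\<epsilon> \<in> {-1, 1}" and z: "z \<in> Q \<epsilon>" and w: "form \<epsilon> w z = 0" "w \<noteq> 0"
  shows "form \<epsilon> w w > 0"
proof (cases "\<epsilon> = 1")
  case True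
  then have "form \<epsilon> w w = w \<bullet> w" by (simp add: form_def inner_prod_def)
  then show ?thesis using w(2) by simp
next
  case False
  then have e: "\<epsilon> = -1" using \<epsilon> by simp
  note n = hyperboloid_norms[OF z[unfolded e]]
  let ?a = "fst w" and ?b = "norm (snd w)"
  have "\<bar>?a\<bar> * fst z = \<bar>snd w \<bullet> snd z\<bar>" using w(1) n(1)
    by (simp add: e form_def abs_mult flip: abs_of_pos[of "fst z"])
      (metis abs_mult abs_of_nonneg norm_ge_zero order_less_imp_le order_trans)
  also have "\<dots> \<le> ?b * norm (snd z)" by (rule Cauchy_Schwarz_ineq2)
  finally have le: "\<bar>?a\<bar> * fst z \<le> ?b * norm (snd z)" .
  have pos: "fst z > 0" using n(1) norm_ge_zero[of "snd z"] by linarith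
  have "?b \<noteq> 0"
  proof
    assume "?b = 0"
    then have "\<bar>?a\<bar> * fst z \<le> 0" using le by simp
    then have "?a = 0" using pos by (simp add: mult_le_0_iff)
    with \<open>?b = 0\<close> w(2) show False by (simp add: prod_eq_iff)
  qed
  then have "?b * norm (snd z) < ?b * fst z" using n(1) by simp
  with le have "\<bar>?a\<bar> < ?b" using pos by (metis mult_less_cancel_right_pos order_le_less_trans)
  then have "?a\<^sup>2 < ?b\<^sup>2" by (metis abs_ge_zero power2_abs power2_less_imp_less power_strict_mono zero_less_numeral)
  then show ?thesis
    by (simp add: e form_def power2_norm_eq_inner power2_eq_square[of "fst w"])
qed

lemma amb_tangent_pos:
  assumes \<epsilon>: "\<epsilon> \<in> {-1, 1}" and z: "z \<in> QR \<epsilon>" and w: "w \<in> tangent_QR \<epsilon> z" "w \<noteq> 0"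
  shows "amb \<epsilon> w w > 0"
proof -
  have z': "fst z \<in> Q \<epsilon>" and w': "form \<epsilon> (fst w) (fst z) = 0"
    using z w(1) by (auto simp: QR_def tangent_QR_def)
  show ?thesis
  proof (cases "fst w = 0")
    case True
    then have "snd w \<noteq> 0" using w(2) by (metis prod_eqI fst_zero snd_zero)
    then show ?thesis using not_real_square_gt_zero[of "snd w"] by (simp add: amb_def form_simps True del: not_real_square_gt_zero)
  next
    case False
    from form_tangent_pos[OF \<epsilon> z' w' this] show ?thesis
      by (simp add: amb_def add_pos_nonneg)
  qed
qed

text \<open>For two timelike unit vectors the product of the first coordinates dominates the spatial
  inner product, so the sign of the form tells whether they lie on the same sheet. Stated this way,
  the sheet condition can be read off in any orthonormal basis starting with
  \<open>z\<close>.\<close>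

lemma fst_pos_iff_form_neg:
  assumes z: "z \<in> Q (-1)" and x: "form (-1) x x = -1"
  shows "fst x > 0 \<longleftrightarrow> form (-1) x z < 0"
proof -
  note n = hyperboloid_norms[OF z]
  have "(norm (snd x))\<^sup>2 < \<bar>fst x\<bar>\<^sup>2"
    using x by (simp add: form_def power2_norm_eq_inner power2_eq_square[of "fst x"])
  then have "norm (snd x) < \<bar>fst x\<bar>" by (rule power2_less_imp_less) simp
  then have "norm (snd x) * norm (snd z) < \<bar>fst x\<bar> * fst z"
    using n(1) by (intro mult_strict_mono') auto
  then have "\<bar>snd x \<bullet> snd z\<bar> < \<bar>fst x\<bar> * fst z"
    using Cauchy_Schwarz_ineq2[of "snd x" "snd z"] by linarith
  moreover have "fst z > 0" using n(1) norm_ge_zero[of "snd z"] by linarith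
  ultimately show ?thesis
    by (cases "fst x > 0") (auto simp: form_def abs_less_iff)
qed

lemma Q_iff_form:
  assumes "\<epsilon> \<in> {-1, 1}" "z \<in> Q \<epsilon>"
  shows "x \<in> Q \<epsilon> \<longleftrightarrow> form \<epsilon> x x = \<epsilon> \<and> (\<epsilon> = -1 \<longrightarrow> form \<epsilon> x z < 0)"
  using assms fst_pos_iff_form_neg[of z x] by (auto simp: Q_def)

text \<open>Gram-Schmidt may break down for an indefinite form. Started at \<open>z\<close> it does
  not: everything orthogonal to \<open>z\<close> has positive square and can be normalised. This
  also produces the signs that \<open>space_form_copy\<close> demands.\<close>

lemma orthonormal_basis_through_point:
  fixes W :: "(real \<times> 'n::euclidean_space) set"
  assumes \<epsilon>: "\<epsilon> \<in> {-1, 1}" and z: "z \<in> Q \<epsilon>" "z \<in> W" and W: "subspace W" "dim W = Suc k"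
  shows "\<exists>e :: nat \<Rightarrow> real \<times> 'n. e 0 = z \<and> (\<forall>i\<le>k. e i \<in> W) \<and>
    (\<forall>i\<le>k. \<forall>j\<le>k. form \<epsilon> (e i) (e j) = (if i \<noteq> j then 0 else if i = 0 then \<epsilon> else 1)) \<and>
    (\<forall>v\<in>W. v = (\<Sum>i\<le>k. ((if i = 0 then \<epsilon> else 1) * form \<epsilon> v (e i)) *\<^sub>R e i))"
proof -
  define s where "s i = (if i = (0::nat) then \<epsilon> else 1)" for i
  have s2: "s i * s i = 1" for i using \<epsilon> by (auto simp: s_def)
  have zz: "form \<epsilon> z z = \<epsilon>" "z \<noteq> 0" using z(1) \<epsilon> by (auto simp: Q_def form_simps)
  \<comment> \<open>Independence is recorded as a dimension, so that comparison with
    \<open>dim W\<close> yields the next vector.\<close>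
  define ortho where "ortho j e \<longleftrightarrow> e 0 = z \<and> (\<forall>i\<le>j. e i \<in> W) \<and>
      (\<forall>i\<le>j. \<forall>i'\<le>j. form \<epsilon> (e i) (e i') = (if i \<noteq> i' then 0 else s i)) \<and> dim (e ` {..j}) = Suc j"
    for j and e :: "nat \<Rightarrow> real \<times> 'n"
  have "\<exists>e. ortho j e" if "j \<le> k" for j
    using that
  proof (induction j)
    case 0
    have "ortho 0 (\<lambda>i. z)"
      using z zz by (simp add: ortho_def s_def dim_insert[of z "{}"])
    then show ?case by blast
  next
    case (Suc j)
    then obtain e where e: "ortho j e" by auto
    then have eW: "e ` {..j} \<subseteq> W" by (auto simp: ortho_def)
    have "\<not> W \<subseteq> span (e ` {..j})"
    proof
      assume "W \<subseteq> span (e ` {..j})"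
      then have "dim W \<le> dim (e ` {..j})" by (metis dim_span dim_subset)
      then show False using Suc.prems W(2) e by (simp add: ortho_def)
    qed
    then obtain v where v: "v \<in> W" "v \<notin> span (e ` {..j})" by blast
    \<comment> \<open>The sign \<open>s i\<close> replaces the division by
      \<open>form \<epsilon> (e i) (e i)\<close>, which equals \<open>s i\<close> and is its own
      inverse.\<close>
    define p where "p = (\<Sum>i\<le>j. (s i * form \<epsilon> v (e i)) *\<^sub>R e i)"
    define n where "n = v - p"
    have p: "p \<in> span (e ` {..j})"
      unfolding p_def by (intro span_sum span_scale span_base) auto
    have "span (e ` {..j}) \<subseteq> W" using eW W(1) by (rule span_minimal)
    then have nW: "n \<in> W" using p v(1) W(1) unfolding n_def by (auto intro: subspace_diff)
    have n_notin: "n \<notin> span (e ` {..j})"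
      using p v(2) span_add[of n "e ` {..j}" p] by (auto simp: n_def)
    have n_orth: "form \<epsilon> n (e i) = 0" if "i \<le> j" for i
    proof -
      have "form \<epsilon> p (e i) = (\<Sum>i'\<le>j. if i' = i then s i * s i * form \<epsilon> v (e i) else 0)"
        unfolding p_def form_simps using e that by (intro sum.cong) (auto simp: ortho_def)
      also have "\<dots> = form \<epsilon> v (e i)" using that by (simp add: s2)
      finally show ?thesis by (simp add: n_def form_simps)
    qed
    have "form \<epsilon> n z = 0" using n_orth[of 0] e by (simp add: ortho_def)
    moreover have "n \<noteq> 0" using n_notin span_zero by auto
    ultimately have nn: "form \<epsilon> n n > 0" using form_tangent_pos[OF \<epsilon> z(1)] by blast
    define a where "a = inverse (sqrt (form \<epsilon> n n))"
    have a: "a \<noteq> 0" "a * (a * form \<epsilon> n n) = 1"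
      using nn by (auto simp: a_def field_simps)
    let ?e = "e(Suc j := a *\<^sub>R n)"
    have "?e ` {..Suc j} = insert (a *\<^sub>R n) (e ` {..j})"
      by (auto simp: atMost_Suc image_iff)
    moreover have "a *\<^sub>R n \<notin> span (e ` {..j})"
    proof
      assume "a *\<^sub>R n \<in> span (e ` {..j})"
      from span_scale[OF this, of "inverse a"] show False using n_notin a(1) by simp
    qed
    ultimately have "dim (?e ` {..Suc j}) = Suc (Suc j)"
      using e by (simp add: dim_insert ortho_def)
    moreover have "form \<epsilon> (?e i) (?e i') = (if i \<noteq> i' then 0 else s i)" if ii': "i \<le> Suc j" "i' \<le> Suc j" for i i'
    proof -
      consider "i \<le> j" "i' \<le> j" | "i = Suc j" "i' \<le> j" | "i \<le> j" "i' = Suc j" | "i = Suc j" "i' = Suc j"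
        using ii' by (meson le_Suc_eq)
      then show ?thesis
      proof cases
        case 1
        then show ?thesis using e by (simp add: ortho_def)
      next
        case 2
        then show ?thesis using n_orth[of i'] by (simp add: form_simps)
      next
        case 3
        then show ?thesis using n_orth[of i] form_commute[of \<epsilon> "e i" n] by (simp add: form_simps)
      next
        case 4
        then show ?thesis using a(2) by (simp add: form_simps s_def)
      qed
    qed
    ultimately have "ortho (Suc j) ?e"
      using e nW W(1) by (auto simp: ortho_def le_Suc_eq subspace_scale)
    then show ?case by blast
  qed
  then obtain e where e: "ortho k e" by blast
  have "e ` {..k} \<subseteq> W" using e by (auto simp: ortho_def)
  then have sp: "span (e ` {..k}) = W"
    using subspace_dim_equal[OF subspace_span W(1)] span_minimal[OF _ W(1)] e W(2) by (simp add: ortho_def)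
  have "v = (\<Sum>i\<le>k. (s i * form \<epsilon> v (e i)) *\<^sub>R e i)" if "v \<in> W" for v
  proof (rule linear_eq_on_span[of "\<lambda>v. v" "\<lambda>v. \<Sum>i\<le>k. (s i * form \<epsilon> v (e i)) *\<^sub>R e i" "e ` {..k}"])
    show "linear (\<lambda>v. \<Sum>i\<le>k. (s i * form \<epsilon> v (e i)) *\<^sub>R e i)"
      by (intro linearI) (simp_all add: form_simps algebra_simps sum.distrib scaleR_sum_right)
    fix b assume "b \<in> e ` {..k}"
    then obtain j where j: "j \<le> k" "b = e j" by auto
    have "(\<Sum>i\<le>k. (s i * form \<epsilon> b (e i)) *\<^sub>R e i) = (\<Sum>i\<le>k. if i = j then (s j * s j) *\<^sub>R e j else 0)"
      using e j by (intro sum.cong) (auto simp: ortho_def)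
    then show "b = (\<Sum>i\<le>k. (s i * form \<epsilon> b (e i)) *\<^sub>R e i)" using j s2 by simp
  qed (use sp that linear_ident in auto)
  then show ?thesis using e by (intro exI[of _ e]) (simp add: ortho_def s_def)
qed

text \<open>Coordinates in a basis with \<open>e 0 = z\<close> turn the form into that of the model.
  Pairing with \<open>z\<close> gives \<open>\<epsilon>\<close> times the zeroth coordinate, so for
  \<open>\<epsilon> = -1\<close> the sheet of \<open>z\<close> is the part with
  \<open>x 0 > 0\<close>.\<close>

lemma space_form_copy_slice:
  fixes W :: "(real \<times> 'n::euclidean_space) set"
  assumes \<epsilon>: "\<epsilon> \<in> {-1, 1}" and z: "z \<in> Q \<epsilon>" "z \<in> W" and W: "subspace W" "dim W = Suc k"
  shows "space_form_copy \<epsilon> k (W \<inter> Q \<epsilon>)"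
proof -
  from orthonormal_basis_through_point[OF assms] obtain e where
    e: "e 0 = z" "\<forall>i\<le>k. e i \<in> W"
    "\<forall>i\<le>k. \<forall>j\<le>k. form \<epsilon> (e i) (e j) = (if i \<noteq> j then 0 else if i = 0 then \<epsilon> else 1)"
    "\<forall>v\<in>W. v = (\<Sum>i\<le>k. ((if i = 0 then \<epsilon> else 1) * form \<epsilon> v (e i)) *\<^sub>R e i)"
    by (elim exE conjE)
  define S where "S x = (\<Sum>i\<le>k. x i *\<^sub>R e i)" for x
  have form_e: "form \<epsilon> (S x) (e j) = x j * (if j = 0 then \<epsilon> else 1)" if "j \<le> k" for x j
  proof -
    have "form \<epsilon> (S x) (e j) = (\<Sum>i\<le>k. if i = j then x j * (if j = 0 then \<epsilon> else 1) else 0)"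
      unfolding S_def form_simps using e(3) that by (intro sum.cong) auto
    then show ?thesis using that by simp
  qed
  have form_S: "form \<epsilon> (S x) (S x) = \<epsilon> * (x 0)\<^sup>2 + (\<Sum>i=1..k. (x i)\<^sup>2)" for x
  proof -
    have "form \<epsilon> (S x) (S x) = (\<Sum>i\<le>k. x i * form \<epsilon> (S x) (e i))"
      unfolding S_def[of x] form_simps(8) form_simps(6) by simp
    also have "\<dots> = (\<Sum>i\<le>k. x i * (x i * (if i = 0 then \<epsilon> else 1)))"
      by (intro sum.cong) (auto simp: form_e)
    also have "\<dots> = \<epsilon> * (x 0)\<^sup>2 + (\<Sum>i=1..k. (x i)\<^sup>2)"
      unfolding atMost_atLeast0 by (subst sum.atLeast_Suc_atMost) (auto simp: power2_eq_square)
    finally show ?thesis .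
  qed
  have Q: "S x \<in> Q \<epsilon> \<longleftrightarrow> \<epsilon> * (x 0)\<^sup>2 + (\<Sum>i=1..k. (x i)\<^sup>2) = \<epsilon> \<and> (\<epsilon> = -1 \<longrightarrow> x 0 > 0)" for x
    unfolding Q_iff_form[OF \<epsilon> z(1)] form_S using form_e[of 0 x] e(1) by auto
  have "\<exists>x. v = S x" if "v \<in> W" for v
    using bspec[OF e(4) that] unfolding S_def by (rule exI[of _ "\<lambda>i. (if i = 0 then \<epsilon> else 1) * form \<epsilon> v (e i)"])
  moreover have "S x \<in> W" for x
    unfolding S_def using e(2) W(1) by (auto intro!: subspace_sum subspace_scale)
  ultimately have "W \<inter> Q \<epsilon> = {S x | x. \<epsilon> * (x 0)\<^sup>2 + (\<Sum>i=1..k. (x i)\<^sup>2) = \<epsilon> \<and> (\<epsilon> = -1 \<longrightarrow> x 0 > 0)}"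
    using Q by blast
  then show ?thesis
    unfolding space_form_copy_def S_def using e(3) by (intro conjI exI[of _ e]) auto
qed

section \<open>Tangent spaces of slices and total geodesy\<close>

lemma vector_derivative_in_subspace:
  fixes \<gamma> :: "real \<Rightarrow> 'a::euclidean_space"
  assumes "(\<gamma> has_vector_derivative w) (at t)" "open I" "t \<in> I" "\<And>s. s \<in> I \<Longrightarrow> \<gamma> s \<in> W" "subspace W"
  shows "w \<in> W"
proof -
  have "orthogonal y w" if y: "y \<in> W\<^sup>\<bottom>" for y
  proof -
    have 1: "((\<lambda>s. y \<bullet> \<gamma> s) has_vector_derivative y \<bullet> w) (at t)"
      by (rule bounded_linear.has_vector_derivative[OF bounded_linear_inner_right assms(1)])
    have 2: "((\<lambda>s. y \<bullet> \<gamma> s) has_vector_derivative 0) (at t)"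
      by (rule has_vector_derivative_transform_within_open[OF has_vector_derivative_const[of 0] assms(2,3)])
        (use y assms(4) in \<open>auto simp: orthogonal_comp_def orthogonal_def inner_commute\<close>)
    show ?thesis using vector_derivative_unique_at[OF 1 2] by (simp add: orthogonal_def)
  qed
  then have "w \<in> W\<^sup>\<bottom>\<^sup>\<bottom>" by (simp add: orthogonal_comp_def)
  then show ?thesis using orthogonal_comp_self[OF assms(5)] by simp
qed

lemma velocity_tangent:
  assumes "(\<gamma> has_vector_derivative w) (at t)" "open I" "t \<in> I" "\<And>s. s \<in> I \<Longrightarrow> \<gamma> s \<in> QR \<epsilon>"
  shows "w \<in> tangent_QR \<epsilon> (\<gamma> t)"
proof -
  have 1: "((\<lambda>s. fst (\<gamma> s)) has_vector_derivative fst w) (at t)"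
    by (rule bounded_linear.has_vector_derivative[OF bounded_linear_fst assms(1)])
  have 2: "((\<lambda>s. form \<epsilon> (fst (\<gamma> s)) (fst (\<gamma> s))) has_vector_derivative
      form \<epsilon> (fst (\<gamma> t)) (fst w) + form \<epsilon> (fst w) (fst (\<gamma> t))) (at t)"
    by (rule bounded_bilinear.has_vector_derivative[OF bounded_bilinear_form 1 1])
  have 3: "((\<lambda>s. form \<epsilon> (fst (\<gamma> s)) (fst (\<gamma> s))) has_vector_derivative 0) (at t)"
    by (rule has_vector_derivative_transform_within_open[OF has_vector_derivative_const[of \<epsilon>] assms(2,3)])
      (use assms(4) in \<open>force simp: QR_def Q_def mem_Times_iff\<close>)
  show ?thesis
    using vector_derivative_unique_at[OF 2 3] form_commute[of \<epsilon> "fst (\<gamma> t)" "fst w"] by (simp add: tangent_QR_def)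
qed

lemma tan_proj_tangent:
  assumes \<epsilon>: "\<epsilon> \<in> {-1, 1}" and "z \<in> QR \<epsilon>"
  shows "tan_proj \<epsilon> z w \<in> tangent_QR \<epsilon> z"
proof -
  have "\<epsilon> * \<epsilon> = 1" using \<epsilon> by auto
  moreover have "form \<epsilon> (fst z) (fst z) = \<epsilon>" using assms(2) by (auto simp: QR_def Q_def)
  ultimately show ?thesis
    by (simp add: tan_proj_def tangent_QR_def form_simps)
qed

text \<open>The inclusion that needs a construction is the one from right to left: each such vector
  must be the velocity of a smooth curve inside the slice. A rational curve serves both signs of
  \<open>\<epsilon>\<close> at once, and its smoothness follows from the rules for products and
  inverses.\<close>

lemma velocities_slice:
  fixes W :: "(real \<times> 'n::euclidean_space) set"
  assumes \<epsilon>: "\<epsilon> \<in> {-1, 1}" and W: "subspace W" and z: "z \<in> (W \<inter> Q \<epsilon>) \<times> UNIV"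
  shows "velocities ((W \<inter> Q \<epsilon>) \<times> UNIV) z = {w \<in> tangent_QR \<epsilon> z. fst w \<in> W}"
proof (intro set_eqI iffI)
  fix w assume "w \<in> velocities ((W \<inter> Q \<epsilon>) \<times> UNIV) z"
  then obtain \<gamma> and \<delta> :: real where \<gamma>: "\<delta> > 0" "\<gamma> ` {-\<delta><..<\<delta>} \<subseteq> (W \<inter> Q \<epsilon>) \<times> UNIV" "\<gamma> 0 = z"
    "(\<gamma> has_vector_derivative w) (at 0)"
    unfolding velocities_def by blast
  have "w \<in> tangent_QR \<epsilon> (\<gamma> 0)"
    by (rule velocity_tangent[OF \<gamma>(4), of "{-\<delta><..<\<delta>}"]) (use \<gamma>(1,2) in \<open>auto simp: QR_def image_subset_iff mem_Times_iff\<close>)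
  moreover have "w \<in> W \<times> UNIV"
    by (rule vector_derivative_in_subspace[OF \<gamma>(4), of "{-\<delta><..<\<delta>}"])
      (use \<gamma>(1,2) W in \<open>auto simp: image_subset_iff mem_Times_iff intro: subspace_Times\<close>)
  ultimately show "w \<in> {w \<in> tangent_QR \<epsilon> z. fst w \<in> W}" using \<gamma>(3) by auto
next
  fix w assume w: "w \<in> {w \<in> tangent_QR \<epsilon> z. fst w \<in> W}"
  define s where "s = form \<epsilon> (fst w) (fst w)"
  have ee: "\<epsilon> * \<epsilon> = 1" "\<bar>\<epsilon>\<bar> = 1" using \<epsilon> by auto
  have zQ: "fst z \<in> Q \<epsilon>" "fst z \<in> W" using z by (auto simp: mem_Times_iff)
  have zz: "form \<epsilon> (fst z) (fst z) = \<epsilon>" using zQ by (auto simp: Q_def)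
  have wz: "form \<epsilon> (fst w) (fst z) = 0" "form \<epsilon> (fst z) (fst w) = 0"
    using w form_commute[of \<epsilon> "fst w"] by (auto simp: tangent_QR_def)
  have "s \<ge> 0"
    using form_tangent_pos[OF \<epsilon> zQ(1) wz(1)] by (cases "fst w = 0") (auto simp: s_def form_simps)
  define \<delta> where "\<delta> = 1 / (1 + s)"
  have \<delta>: "\<delta> > 0" using \<open>s \<ge> 0\<close> by (simp add: \<delta>_def)
  txt \<open>Rational (stereographic) parametrization of the geodesic with velocity \<^term>\<open>fst w\<close>.\<close>
  define \<tau> where "\<tau> t = \<epsilon> * s * (t * t) / 4" for t
  define D where "D t = inverse (1 + \<tau> t)" for t
  define \<gamma> where "\<gamma> t = (D t * (1 - \<tau> t)) *\<^sub>R (fst z, 0) + (D t * t) *\<^sub>R (fst w, 0) + (t *\<^sub>R (0, snd w) + (0, snd z))" for t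
  have \<tau>: "\<bar>\<tau> t\<bar> < 1" if "t \<in> {-\<delta><..<\<delta>}" for t
  proof -
    have "\<bar>t\<bar> \<le> \<delta>" using that by auto
    then have "\<bar>t\<bar> * \<bar>t\<bar> \<le> \<delta> * \<delta>" by (intro mult_mono) (use \<delta> in auto)
    then have "s * (\<bar>t\<bar> * \<bar>t\<bar>) \<le> s * (\<delta> * \<delta>)" using \<open>s \<ge> 0\<close> by (rule mult_left_mono)
    also have "\<dots> \<le> 1"
    proof -
      have "s * \<delta> \<le> 1" "\<delta> \<le> 1" using \<open>s \<ge> 0\<close> by (auto simp: \<delta>_def field_simps)
      then have "(s * \<delta>) * \<delta> \<le> 1 * 1" using \<delta> by (intro mult_mono) auto
      then show ?thesis by (simp add: mult.assoc)
    qed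
    finally show ?thesis using ee \<open>s \<ge> 0\<close> by (simp add: \<tau>_def abs_mult)
  qed
  let ?I = "{-\<delta><..<\<delta>}"
  have nz: "1 + \<tau> t > 0" "1 - \<tau> t > 0" if "t \<in> ?I" for t
    using \<tau>[OF that] by auto
  have fst\<gamma>: "fst (\<gamma> t) = (D t * (1 - \<tau> t)) *\<^sub>R fst z + (D t * t) *\<^sub>R fst w" for t
    by (simp add: \<gamma>_def)
  have "\<gamma> t \<in> (W \<inter> Q \<epsilon>) \<times> UNIV" if t: "t \<in> ?I" for t
  proof -
    have D: "D t * (1 + \<tau> t) = 1" "D t > 0" using nz[OF t] by (auto simp: D_def)
    have "form \<epsilon> (fst (\<gamma> t)) (fst (\<gamma> t)) = \<epsilon> * (D t * (1 - \<tau> t))\<^sup>2 + s * (D t * t)\<^sup>2"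
      by (simp add: fst\<gamma> form_simps zz wz s_def power2_eq_square)
    \<comment> \<open>Origin of the 4 in \<open>\<tau>\<close>: since
      \<open>\<epsilon> * \<epsilon> = 1\<close>, the product \<open>s * (t * t)\<close> equals
      \<open>4 * \<epsilon> * \<tau> t\<close>, and
      \<open>(1 - \<tau>)^2 + 4 * \<tau> = (1 + \<tau>)^2\<close> then cancels the
      denominator.\<close>
    also have "s * (D t * t)\<^sup>2 = \<epsilon> * ((D t)\<^sup>2 * (4 * \<tau> t))"
      using ee(1) by (simp add: \<tau>_def power2_eq_square)
    also have "\<epsilon> * (D t * (1 - \<tau> t))\<^sup>2 + \<epsilon> * ((D t)\<^sup>2 * (4 * \<tau> t)) = \<epsilon> * (D t * (1 + \<tau> t))\<^sup>2"
      by (simp add: power2_eq_square algebra_simps)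
    finally have "form \<epsilon> (fst (\<gamma> t)) (fst (\<gamma> t)) = \<epsilon>" using D(1) by simp
    moreover have "form \<epsilon> (fst (\<gamma> t)) (fst z) = \<epsilon> * (D t * (1 - \<tau> t))"
      by (simp add: fst\<gamma> form_simps zz wz)
    moreover have "D t * (1 - \<tau> t) > 0" using D(2) nz(2)[OF t] by simp
    ultimately have "fst (\<gamma> t) \<in> Q \<epsilon>"
      unfolding Q_iff_form[OF \<epsilon> zQ(1)] by auto
    moreover have "fst (\<gamma> t) \<in> W"
      unfolding fst\<gamma> using zQ(2) w W by (auto intro: subspace_add subspace_scale)
    ultimately show ?thesis by (simp add: mem_Times_iff)
  qed
  then have "\<gamma> ` ?I \<subseteq> (W \<inter> Q \<epsilon>) \<times> UNIV" by (rule image_subsetI)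
  moreover have "smooth_on ?I \<gamma>"
  proof -
    have id: "smooth_on ?I (\<lambda>t. t)" by (rule smooth_on_ident) simp
    have "smooth_on ?I \<tau>"
      unfolding \<tau>_def divide_inverse
      by (intro smooth_on_bounded_bilinear[OF bounded_bilinear_mult] smooth_on_const id) auto
    moreover from this have "smooth_on ?I D"
      unfolding D_def using nz by (intro smooth_on_inverse smooth_on_add smooth_on_const) force+
    ultimately show ?thesis unfolding \<gamma>_def
      by (intro smooth_on_add smooth_on_bounded_bilinear[OF bounded_bilinear_scaleR]
          smooth_on_bounded_bilinear[OF bounded_bilinear_mult] smooth_on_diff smooth_on_const id) auto
  qed
  moreover have "\<gamma> 0 = z"
    by (simp add: \<gamma>_def D_def \<tau>_def prod_eq_iff)
  moreover have "(\<gamma> has_vector_derivative w) (at 0)"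
  proof -
    \<comment> \<open>As \<open>\<tau>\<close> is quadratic in \<open>t\<close>, the coefficient of
      \<open>fst z\<close> is stationary at 0 while that of \<open>fst w\<close> has derivative
      1.\<close>
    have \<tau>': "(\<tau> has_real_derivative 0) (at 0)" and \<tau>0: "\<tau> 0 = 0"
      unfolding \<tau>_def by (auto intro!: derivative_eq_intros)
    have D': "(D has_real_derivative 0) (at 0)" and D0: "D 0 = 1"
      unfolding D_def using \<tau>0 by (auto intro!: derivative_eq_intros \<tau>')
    have "((\<lambda>t. D t * (1 - \<tau> t)) has_real_derivative 0) (at 0)"
      "((\<lambda>t. D t * t) has_real_derivative 1) (at 0)"
      using \<tau>0 D0 by (auto intro!: derivative_eq_intros \<tau>' D')
    moreover have sc: "((\<lambda>t. h t *\<^sub>R a) has_vector_derivative h' *\<^sub>R a) (at 0)"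
      if "(h has_real_derivative h') (at 0)" for h h' and a :: "(real \<times> 'n) \<times> real"
      by (rule bounded_linear.has_vector_derivative[OF bounded_linear_scaleR_left])
        (use that has_real_derivative_iff_has_vector_derivative in blast)
    moreover have "((\<lambda>t. t *\<^sub>R a) has_vector_derivative 1 *\<^sub>R a) (at 0)"
      for a :: "(real \<times> 'n) \<times> real"
      using sc[of "\<lambda>t. t", OF DERIV_ident] .
    ultimately have "(\<gamma> has_vector_derivative 0 *\<^sub>R (fst z, 0) + 1 *\<^sub>R (fst w, 0) + (1 *\<^sub>R (0, snd w) + 0)) (at 0)"
      unfolding \<gamma>_def by (intro has_vector_derivative_add has_vector_derivative_const)
    then show ?thesis by simp
  qed
  ultimately show "w \<in> velocities ((W \<inter> Q \<epsilon>) \<times> UNIV) z"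
    unfolding velocities_def using \<delta> by (intro CollectI exI[of _ \<gamma>] exI[of _ \<delta>]) auto
qed

text \<open>All tangent spaces of the slice lie in the fixed subspace
  \<open>W \<times> UNIV\<close>. A flat derivative of a tangent field stays there, and the
  projection subtracts only a multiple of the position vector, which lies in \<open>W\<close> as
  well.\<close>

lemma totally_geodesic_slice:
  fixes W :: "(real \<times> 'n::euclidean_space) set"
  assumes \<epsilon>: "\<epsilon> \<in> {-1, 1}" and W: "subspace W"
  shows "totally_geodesic \<epsilon> ((W \<inter> Q \<epsilon>) \<times> UNIV)"
  unfolding totally_geodesic_def
proof (intro conjI allI impI ballI)
  let ?S = "(W \<inter> Q \<epsilon>) \<times> (UNIV :: real set)"
  show "?S \<subseteq> QR \<epsilon>" by (auto simp: QR_def)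
  fix a b s :: real and \<gamma> Y :: "real \<Rightarrow> (real \<times> 'n) \<times> real"
  assume Y: "smooth_on {a<..<b} Y"
    and S: "\<forall>s\<in>{a<..<b}. \<gamma> s \<in> ?S \<and> Y s \<in> velocities ?S (\<gamma> s)" and s: "s \<in> {a<..<b}"
  have \<gamma>s: "\<gamma> s \<in> ?S" using S s by blast
  have "(Y has_vector_derivative vector_derivative Y (at s)) (at s)"
    using smooth_on_differentiable[OF Y s] vector_derivative_works by blast
  then have "vector_derivative Y (at s) \<in> W \<times> UNIV"
  proof (rule vector_derivative_in_subspace[where I = "{a<..<b}"])
    fix r assume "r \<in> {a<..<b}"
    then have "\<gamma> r \<in> ?S" "Y r \<in> velocities ?S (\<gamma> r)" using S by auto
    then show "Y r \<in> W \<times> UNIV" using velocities_slice[OF \<epsilon> W] by (auto simp: mem_Times_iff)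
  qed (use s W in \<open>auto intro: subspace_Times\<close>)
  then have "fst (tan_proj \<epsilon> (\<gamma> s) (vector_derivative Y (at s))) \<in> W"
    using \<gamma>s W by (auto simp: tan_proj_def mem_Times_iff intro!: subspace_diff subspace_scale)
  moreover have "\<gamma> s \<in> QR \<epsilon>" using \<gamma>s by (auto simp: QR_def)
  ultimately show "tan_proj \<epsilon> (\<gamma> s) (vector_derivative Y (at s)) \<in> velocities ?S (\<gamma> s)"
    unfolding velocities_slice[OF \<epsilon> W \<gamma>s] using tan_proj_tangent[OF \<epsilon>] by simp
qed

section \<open>Normal components along an immersion\<close>

text \<open>Gram-Schmidt, one basis vector at a time; no inverse of the Gram matrix is needed.\<close>

lemma smooth_projection:
  fixes X :: "'m::euclidean_space \<Rightarrow> 'm \<Rightarrow> (real \<times> 'n::euclidean_space) \<times> real"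
  assumes "open S"
    and lin: "\<And>y. y \<in> S \<Longrightarrow> linear (X y)"
    and sm: "\<And>b. smooth_on S (\<lambda>y. X y b)"
    and pos: "\<And>y u. y \<in> S \<Longrightarrow> u \<noteq> 0 \<Longrightarrow> amb \<epsilon> (X y u) (X y u) > 0"
    and "B \<subseteq> Basis" "smooth_on S w"
  shows "\<exists>\<pi>. smooth_on S \<pi> \<and>
    (\<forall>y\<in>S. \<pi> y \<in> X y ` span B \<and> (\<forall>u\<in>span B. amb \<epsilon> (w y - \<pi> y) (X y u) = 0))"
proof -
  have "finite B" using assms(5) finite_subset finite_Basis by blast
  then show ?thesis using assms(5,6)
  \<comment> \<open>The induction hypothesis is used twice, for the given field and for the new
    frame field \<open>X y b\<close>; hence \<open>w\<close> is arbitrary.\<close>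
  proof (induction B arbitrary: w)
    case empty
    have "X y 0 = 0" if "y \<in> S" for y using lin[OF that] linear_0 by blast
    then show ?case
      by (intro exI[of _ "\<lambda>y. 0"]) (auto simp: smooth_on_const image_iff amb_simps)
  next
    case (insert b B)
    then have B: "B \<subseteq> Basis" by simp
    obtain \<pi>w where \<pi>w: "smooth_on S \<pi>w" "\<And>y. y \<in> S \<Longrightarrow> \<pi>w y \<in> X y ` span B"
      "\<And>y u. y \<in> S \<Longrightarrow> u \<in> span B \<Longrightarrow> amb \<epsilon> (w y - \<pi>w y) (X y u) = 0"
      using insert.IH[OF B insert.prems(2)] by blast
    obtain \<pi>b where \<pi>b: "smooth_on S \<pi>b" "\<And>y. y \<in> S \<Longrightarrow> \<pi>b y \<in> X y ` span B"
      "\<And>y u. y \<in> S \<Longrightarrow> u \<in> span B \<Longrightarrow> amb \<epsilon> (X y b - \<pi>b y) (X y u) = 0"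
      using insert.IH[OF B sm[of b]] by blast
    \<comment> \<open>\<open>n\<close> is the frame field \<open>X y b\<close> without its
      components along the earlier ones. It is the image of the nonzero vector \<open>b - u\<close>
      with \<open>u\<close> in \<open>span B\<close>, so \<open>pos\<close> permits division by its
      square although \<open>amb\<close> may be indefinite.\<close>
    define n where "n y = X y b - \<pi>b y" for y
    define k where "k y = amb \<epsilon> (w y - \<pi>w y) (n y) * inverse (amb \<epsilon> (n y) (n y))" for y
    define \<pi> where "\<pi> y = \<pi>w y + k y *\<^sub>R n y" for y
    have "independent (insert b B)"
      using independent_Basis insert.prems(1) independent_mono by blast
    then have b: "b \<notin> span B" using insert.hyps(2) by (simp add: independent_insert)
    have n: "\<exists>u. u \<in> span B \<and> n y = X y (b - u)" "amb \<epsilon> (n y) (n y) > 0" if y: "y \<in> S" for y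
    proof -
      obtain u where u: "u \<in> span B" "\<pi>b y = X y u" using \<pi>b(2)[OF y] by blast
      have nu: "n y = X y (b - u)" using u(2) linear_diff[OF lin[OF y]] by (simp add: n_def)
      then show "\<exists>u. u \<in> span B \<and> n y = X y (b - u)" using u(1) by blast
      have "b - u \<noteq> 0" using b u(1) by auto
      then show "amb \<epsilon> (n y) (n y) > 0" using pos[OF y] nu by simp
    qed
    have sm_n: "smooth_on S n"
      unfolding n_def by (intro smooth_on_diff assms(1) sm \<pi>b(1))
    have "smooth_on S k"
      unfolding k_def using n(2)
      by (intro smooth_on_bounded_bilinear[OF bounded_bilinear_mult] smooth_on_inverse
          smooth_on_bounded_bilinear[OF bounded_bilinear_amb] smooth_on_diff assms(1) insert.prems(2) \<pi>w(1) sm_n)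
        force
    then have "smooth_on S \<pi>"
      unfolding \<pi>_def by (intro smooth_on_add smooth_on_bounded_bilinear[OF bounded_bilinear_scaleR] assms(1) \<pi>w(1) sm_n)
    moreover have "\<pi> y \<in> X y ` span (insert b B) \<and> (\<forall>u\<in>span (insert b B). amb \<epsilon> (w y - \<pi> y) (X y u) = 0)"
      if y: "y \<in> S" for y
    proof
      obtain u where u: "u \<in> span B" "n y = X y (b - u)" using n(1)[OF y] by blast
      obtain u' where u': "u' \<in> span B" "\<pi>w y = X y u'" using \<pi>w(2)[OF y] by blast
      have "\<pi> y = X y (u' + k y *\<^sub>R (b - u))"
        unfolding \<pi>_def u(2) u'(2) using lin[OF y] by (simp add: linear_add linear_scale)
      moreover have "u' + k y *\<^sub>R (b - u) \<in> span (insert b B)"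
        using u(1) u'(1) span_mono[of B "insert b B"]
        by (intro span_add span_scale span_diff) (auto intro: span_base)
      ultimately show "\<pi> y \<in> X y ` span (insert b B)" by blast
      have B0: "amb \<epsilon> (w y - \<pi> y) (X y v) = 0" if "v \<in> span B" for v
        using \<pi>w(3)[OF y that] \<pi>b(3)[OF y that]
        by (simp add: \<pi>_def amb_simps n_def)
      have n0: "amb \<epsilon> (w y - \<pi> y) (n y) = 0"
        using n(2)[OF y] by (simp add: \<pi>_def diff_diff_eq[symmetric] amb_simps k_def mult.assoc)
      have "X y b = n y + X y u" using u(2) linear_diff[OF lin[OF y]] by simp
      then have b0: "amb \<epsilon> (w y - \<pi> y) (X y b) = 0"
        using n0 B0[OF u(1)] by (simp add: amb_simps)
      show "\<forall>v\<in>span (insert b B). amb \<epsilon> (w y - \<pi> y) (X y v) = 0"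
      proof
        fix v assume "v \<in> span (insert b B)"
        then obtain r where r: "v - r *\<^sub>R b \<in> span B" using span_breakdown_eq by blast
        have "X y v = X y (v - r *\<^sub>R b) + r *\<^sub>R X y b"
          using lin[OF y] by (simp add: linear_diff linear_scale)
        then show "amb \<epsilon> (w y - \<pi> y) (X y v) = 0"
          using B0[OF r] b0 by (simp only: amb_simps) simp
      qed
    qed
    ultimately show ?case by blast
  qed
qed

text \<open>The vector \<open>(fst (f p), 0)\<close> spans the line that \<open>tan_proj\<close>
  removes; the real coordinate of the position is left out because the ambient product is flat in
  that direction.\<close>

definition adapted_space ::
  "('p, 'm::euclidean_space) chart set \<Rightarrow> ('p \<Rightarrow> (real \<times> 'n::euclidean_space) \<times> real)
     \<Rightarrow> ('p \<Rightarrow> ((real \<times> 'n) \<times> real) set) \<Rightarrow> 'p \<Rightarrow> ((real \<times> 'n) \<times> real) set" where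
  "adapted_space A f L p = span (insert (fst (f p), 0) (push_space A f p \<union> L p))"

section \<open>Splitting into tangential and normal components\<close>

context
  fixes \<epsilon> :: real
    and A :: "('p::{t2_space, second_countable_topology}, 'm::euclidean_space) chart set"
    and g :: "('p, 'm) chart \<Rightarrow> 'p \<Rightarrow> 'm \<Rightarrow> 'm \<Rightarrow> real"
    and f :: "'p \<Rightarrow> (real \<times> 'n::euclidean_space) \<times> real"
  assumes \<epsilon>: "\<epsilon> \<in> {-1, 1}" and atlas: "smooth_atlas A" and immersion: "isometric_immersion \<epsilon> A g f"
begin

lemma f_QR: "f p \<in> QR \<epsilon>"
  using immersion unfolding isometric_immersion_def by blast

lemma f_smooth: "smooth_map A UNIV f"
  using immersion unfolding isometric_immersion_def by blast

lemma df_inj: "c \<in> charts_at A p \<Longrightarrow> inj (dmap c f p)"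
  using immersion unfolding isometric_immersion_def by blast

lemmas df_linear = dmap_linear[OF atlas f_smooth UNIV_I]

lemma push_space_eq:
  assumes "c \<in> charts_at A p"
  shows "push_space A f p = range (dmap c f p)"
proof -
  have "range (dmap d f p) \<subseteq> range (dmap c f p)" if "d \<in> charts_at A p" for d
    using dmap_chart_change[OF atlas f_smooth UNIV_I assms that] by (metis image_subsetI rangeI)
  then show ?thesis using assms unfolding push_space_def by blast
qed

lemma subspace_push_space: "subspace (push_space A f p)"
proof -
  obtain c where c: "c \<in> charts_at A p" using charts_at_nonempty[OF atlas] by blast
  show ?thesis
    unfolding push_space_eq[OF c] by (rule linear_subspace_image[OF df_linear[OF c] subspace_UNIV])
qed

lemma dim_push_space: "dim (push_space A f p) = DIM('m)"
proof -
  obtain c where c: "c \<in> charts_at A p" using charts_at_nonempty[OF atlas] by blast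
  show ?thesis
    unfolding push_space_eq[OF c] using dim_image_eq[OF df_linear[OF c], of UNIV] df_inj[OF c] by simp
qed

lemma subspace_tangent_QR: "subspace (tangent_QR \<epsilon> z)"
  by (simp add: subspace_def tangent_QR_def form_simps)

lemma push_space_tangent: "push_space A f p \<subseteq> tangent_QR \<epsilon> (f p)"
proof -
  obtain c where c: "c \<in> charts_at A p" using charts_at_nonempty[OF atlas] by blast
  then have cA: "c \<in> A" "p \<in> fst c" by (auto simp: charts_at_def)
  have "dmap c f p u \<in> tangent_QR \<epsilon> (f p)" for u
  proof -
    \<comment> \<open>The coordinate line is mapped to \<open>QR\<close> for every \<open>t\<close>,
      even where it leaves the chart domain, because all values of \<open>f\<close> lie there. So
      the whole real line can serve as the parameter interval.\<close>
    let ?\<sigma> = "\<lambda>t::real. snd c p + t *\<^sub>R u"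
    have "(?\<sigma> has_derivative (\<lambda>s. s *\<^sub>R u)) (at 0)"
      by (auto intro!: derivative_eq_intros)
    moreover have "((f \<circ> param c) has_derivative dmap c f p) (at (?\<sigma> 0))"
      using dmap_has_derivative[OF atlas f_smooth UNIV_I c] by simp
    ultimately have "((f \<circ> param c) \<circ> ?\<sigma> has_derivative dmap c f p \<circ> (\<lambda>s. s *\<^sub>R u)) (at 0)"
      by (rule diff_chain_at)
    then have "((f \<circ> param c) \<circ> ?\<sigma> has_vector_derivative dmap c f p u) (at 0)"
      unfolding has_vector_derivative_def using linear_scale[OF df_linear[OF c]] by (simp add: o_def)
    from velocity_tangent[OF this open_UNIV UNIV_I] show ?thesis
      using f_QR param_chart[OF atlas cA] by (simp add: o_def)
  qed
  then show ?thesis unfolding push_space_eq[OF c] by blast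
qed

lemma push_space_pos: "w \<in> push_space A f p \<Longrightarrow> w \<noteq> 0 \<Longrightarrow> amb \<epsilon> w w > 0"
  by (rule amb_tangent_pos[OF \<epsilon> f_QR subsetD[OF push_space_tangent]])

lemma subspace_normal_fibre: "subspace (normal_fibre \<epsilon> A f p)"
  using subspace_tangent_QR[of "f p"] unfolding subspace_def normal_fibre_def
  by (simp add: amb_simps(1,3,4))

lemma push_normal_disjoint: "w \<in> push_space A f p \<Longrightarrow> w \<in> normal_fibre \<epsilon> A f p \<Longrightarrow> w = 0"
proof -
  assume w: "w \<in> push_space A f p" "w \<in> normal_fibre \<epsilon> A f p"
  then have "amb \<epsilon> w w = 0" unfolding normal_fibre_def by blast
  then show "w = 0" using push_space_pos[OF w(1)] by auto
qed

text \<open>Two decompositions differ by a vector that is both tangential and normal, hence zero by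
  positivity. This evaluates the \<open>THE\<close> in \<open>normal_part\<close>.\<close>

lemma normal_part_eqI:
  assumes "\<xi> \<in> normal_fibre \<epsilon> A f p" "w - \<xi> \<in> push_space A f p"
  shows "normal_part \<epsilon> A f p w = \<xi>"
  unfolding normal_part_def
proof (rule the_equality)
  fix \<zeta> assume \<zeta>: "\<zeta> \<in> normal_fibre \<epsilon> A f p \<and> w - \<zeta> \<in> push_space A f p"
  have "(w - \<xi>) - (w - \<zeta>) \<in> push_space A f p"
    using \<zeta> assms(2) subspace_push_space by (blast intro: subspace_diff)
  moreover have "\<zeta> - \<xi> \<in> normal_fibre \<epsilon> A f p"
    using \<zeta> assms(1) subspace_normal_fibre by (blast intro: subspace_diff)
  ultimately show "\<zeta> = \<xi>" using push_normal_disjoint[of "\<zeta> - \<xi>"] by simp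
qed (use assms in blast)

text \<open>Gram-Schmidt for the full coordinate frame. It serves twice: pointwise for the existence
  of normal components, and over the chart for their smoothness.\<close>

lemma tangential_projection:
  assumes c: "c \<in> A" and w: "smooth_on (snd c ` fst c) w"
  shows "\<exists>\<pi>. smooth_on (snd c ` fst c) \<pi> \<and> (\<forall>q\<in>fst c. \<pi> (snd c q) \<in> push_space A f q) \<and>
    (\<forall>q\<in>fst c. \<forall>z\<in>push_space A f q. amb \<epsilon> (w (snd c q) - \<pi> (snd c q)) z = 0)"
proof -
  let ?S = "snd c ` fst c"
  let ?X = "\<lambda>y. frechet_derivative (f \<circ> param c) (at y)"
  have X: "?X (snd c q) = dmap c f q" for q by (simp add: dmap_def[abs_def])
  have ch: "c \<in> charts_at A q" if "q \<in> fst c" for q using c that by (simp add: charts_at_def)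
  have f_c: "smooth_on ?S (f \<circ> param c)"
    using f_smooth c unfolding smooth_map_def by simp
  have "\<exists>\<pi>. smooth_on ?S \<pi> \<and> (\<forall>y\<in>?S. \<pi> y \<in> ?X y ` span Basis \<and> (\<forall>u\<in>span Basis. amb \<epsilon> (w y - \<pi> y) (?X y u) = 0))"
  proof (rule smooth_projection[OF chart_homeomorphism(2)[OF atlas c]])
    show "smooth_on ?S (\<lambda>y. ?X y b)" for b
      using f_c by (rule smooth_on_frechet_derivative)
    fix y assume "y \<in> ?S"
    then obtain q where q: "q \<in> fst c" "y = snd c q" by blast
    show "linear (?X y)" unfolding q(2) X by (rule df_linear[OF ch[OF q(1)]])
    fix u :: 'm assume "u \<noteq> 0"
    then have "dmap c f q u \<noteq> 0"
      using df_inj[OF ch[OF q(1)]] linear_0[OF df_linear[OF ch[OF q(1)]]] by (metis injD)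
    then show "amb \<epsilon> (?X y u) (?X y u) > 0"
      unfolding q(2) X using push_space_pos push_space_eq[OF ch[OF q(1)]] by blast
  qed (use w in auto)
  then obtain \<pi> where \<pi>: "smooth_on ?S \<pi>" "\<forall>y\<in>?S. \<pi> y \<in> range (?X y)"
    "\<forall>y\<in>?S. \<forall>u. amb \<epsilon> (w y - \<pi> y) (?X y u) = 0"
    unfolding span_Basis by auto
  show ?thesis
  proof (intro exI[of _ \<pi>] conjI ballI)
    show "smooth_on ?S \<pi>" by (rule \<pi>(1))
    fix q assume q: "q \<in> fst c"
    then show "\<pi> (snd c q) \<in> push_space A f q"
      unfolding push_space_eq[OF ch[OF q]] X[symmetric] using \<pi>(2) by simp
    show "amb \<epsilon> (w (snd c q) - \<pi> (snd c q)) z = 0" if z: "z \<in> push_space A f q" for z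
    proof -
      obtain u where "z = ?X (snd c q) u"
        using z unfolding push_space_eq[OF ch[OF q]] X[symmetric] by blast
      then show ?thesis using \<pi>(3) q by simp
    qed
  qed
qed

lemma normal_part_eq_projection:
  assumes "w \<in> tangent_QR \<epsilon> (f p)" "v \<in> push_space A f p" "\<And>z. z \<in> push_space A f p \<Longrightarrow> amb \<epsilon> (w - v) z = 0"
  shows "normal_part \<epsilon> A f p w = w - v"
proof (rule normal_part_eqI)
  have "w - v \<in> tangent_QR \<epsilon> (f p)"
    by (rule subspace_diff[OF subspace_tangent_QR assms(1) subsetD[OF push_space_tangent assms(2)]])
  then show "w - v \<in> normal_fibre \<epsilon> A f p" using assms(3) by (simp add: normal_fibre_def)
qed (use assms(2) in simp)

lemma tangential_part:
  assumes "w \<in> tangent_QR \<epsilon> (f p)"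
  shows "w - normal_part \<epsilon> A f p w \<in> push_space A f p"
proof -
  obtain c where c: "c \<in> charts_at A p" using charts_at_nonempty[OF atlas] by blast
  then have cA: "c \<in> A" "p \<in> fst c" by (auto simp: charts_at_def)
  obtain \<pi> where \<pi>: "\<forall>q\<in>fst c. \<pi> (snd c q) \<in> push_space A f q"
    "\<forall>q\<in>fst c. \<forall>z\<in>push_space A f q. amb \<epsilon> (w - \<pi> (snd c q)) z = 0"
    \<comment> \<open>The constant extension of \<open>w\<close> is known to be tangent to
      \<open>QR\<close> at \<open>p\<close> alone, but the projection exists for arbitrary fields;
      tangency enters only afterwards, at \<open>p\<close>.\<close>
    using tangential_projection[OF cA(1) smooth_on_const[of _ w]] by (elim exE conjE)
  have "normal_part \<epsilon> A f p w = w - \<pi> (snd c p)"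
    using \<pi>(2) cA(2) by (intro normal_part_eq_projection assms bspec[OF \<pi>(1)]) auto
  then show ?thesis using \<pi>(1) cA(2) by simp
qed

lemma smooth_normal_part:
  assumes c: "c \<in> A" and w: "smooth_on (snd c ` fst c) w"
    and tan: "\<And>q. q \<in> fst c \<Longrightarrow> w (snd c q) \<in> tangent_QR \<epsilon> (f q)"
  shows "smooth_map A (fst c) (\<lambda>q. normal_part \<epsilon> A f q (w (snd c q)))"
proof -
  let ?S = "snd c ` fst c"
  obtain \<pi> where \<pi>: "smooth_on ?S \<pi>" "\<forall>q\<in>fst c. \<pi> (snd c q) \<in> push_space A f q"
    "\<forall>q\<in>fst c. \<forall>z\<in>push_space A f q. amb \<epsilon> (w (snd c q) - \<pi> (snd c q)) z = 0"
    using tangential_projection[OF c w] by (elim exE conjE)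
  have n: "normal_part \<epsilon> A f q (w (snd c q)) = w (snd c q) - \<pi> (snd c q)" if "q \<in> fst c" for q
    by (rule normal_part_eq_projection[OF tan[OF that] bspec[OF \<pi>(2) that] bspec[OF bspec[OF \<pi>(3) that]]])
  note op = chart_homeomorphism(2)[OF atlas c]
  have "smooth_on ?S ((\<lambda>q. normal_part \<epsilon> A f q (w (snd c q))) \<circ> param c)"
    by (rule smooth_on_cong[OF op _ smooth_on_diff[OF op w \<pi>(1)]])
      (use n param_chart[OF atlas c] in auto)
  then show ?thesis
    by (intro smooth_map_chartI[OF atlas c chart_homeomorphism(1)[OF atlas c]]) auto
qed

lemma smooth_df:
  assumes c: "c \<in> A"
  shows "smooth_map A (fst c) (\<lambda>q. dmap c f q v)"
proof -
  note op = chart_homeomorphism(2)[OF atlas c]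
  have "smooth_on (snd c ` fst c) (f \<circ> param c)"
    using f_smooth c unfolding smooth_map_def by simp
  then have "smooth_on (snd c ` fst c) (\<lambda>y. frechet_derivative (f \<circ> param c) (at y) v)"
    by (rule smooth_on_frechet_derivative)
  then have "smooth_on (snd c ` fst c) ((\<lambda>q. dmap c f q v) \<circ> param c)"
    by (rule smooth_on_cong[OF op, rotated]) (use param_chart[OF atlas c] in \<open>auto simp: dmap_def\<close>)
  then show ?thesis
    by (intro smooth_map_chartI[OF atlas c chart_homeomorphism(1)[OF atlas c]]) auto
qed

text \<open>The condition on the normal connection speaks of smooth sections of the first normal
  space. These fields, with constant components \<open>u\<close> and \<open>v\<close>, are the ones
  to which it is applied.\<close>

lemma smooth_second_ff:
  assumes c: "c \<in> A"
  shows "smooth_map A (fst c) (\<lambda>q. second_ff \<epsilon> A f c q u v)"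
proof -
  let ?S = "snd c ` fst c"
  let ?F = "\<lambda>q. dmap c f q v"
  note op = chart_homeomorphism(2)[OF atlas c]
  define w where "w y = tan_proj \<epsilon> (f (param c y)) (frechet_derivative (?F \<circ> param c) (at y) u)" for y
  have w: "w (snd c q) = cov_deriv \<epsilon> f c ?F q u" if "q \<in> fst c" for q
    using param_chart[OF atlas c that] by (simp add: w_def cov_deriv_def dmap_def)
  have "smooth_on ?S (\<lambda>y. f (param c y))"
    using f_smooth c unfolding smooth_map_def o_def by simp
  moreover have "smooth_on ?S (\<lambda>y. frechet_derivative (?F \<circ> param c) (at y) u)"
    using smooth_df[OF c] c unfolding smooth_map_def by (intro smooth_on_frechet_derivative) (metis Int_absorb)
  moreover have "bounded_linear (\<lambda>z::(real \<times> 'n) \<times> real. (fst z, 0 :: real))"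
    by (intro bounded_linear_Pair bounded_linear_fst bounded_linear_zero)
  ultimately have "smooth_on ?S w"
    unfolding w_def tan_proj_def
    by (intro smooth_on_diff op smooth_on_bounded_bilinear[OF bounded_bilinear_scaleR]
        smooth_on_bounded_bilinear[OF bounded_bilinear_mult] smooth_on_const
        smooth_on_bounded_bilinear[OF bounded_bilinear_form] smooth_on_bounded_linear[OF bounded_linear_fst]
        smooth_on_bounded_linear[of "\<lambda>z. (fst z, 0)"])
  moreover have "w (snd c q) \<in> tangent_QR \<epsilon> (f q)" if "q \<in> fst c" for q
    unfolding w[OF that] cov_deriv_def by (rule tan_proj_tangent[OF \<epsilon> f_QR])
  ultimately have "smooth_map A (fst c) (\<lambda>q. normal_part \<epsilon> A f q (w (snd c q)))"
    by (rule smooth_normal_part[OF c])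
  then show ?thesis
    unfolding smooth_map_def
  proof (intro ballI)
    fix d assume d: "d \<in> A" and *: "\<forall>d\<in>A. smooth_on (snd d ` (fst d \<inter> fst c)) ((\<lambda>q. normal_part \<epsilon> A f q (w (snd c q))) \<circ> param d)"
    show "smooth_on (snd d ` (fst d \<inter> fst c)) ((\<lambda>q. second_ff \<epsilon> A f c q u v) \<circ> param d)"
      by (rule smooth_on_cong[OF open_chart_image[OF atlas d chart_homeomorphism(1)[OF atlas c]] _ bspec[OF * d]])
        (use w param_chart[OF atlas d] in \<open>auto simp: second_ff_def\<close>)
  qed
qed


section \<open>The adapted bundle\<close>

text \<open>Tangential and normal vectors meet only in zero, by positivity. The final
  \<open>1\<close> is the position vector, which is not tangent to \<open>QR\<close> because its
  square is \<open>\<epsilon>\<close> and not zero.\<close>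

lemma dim_adapted_space:
  assumes "subspace (L p)" "L p \<subseteq> normal_fibre \<epsilon> A f p"
  shows "dim (adapted_space A f L p) = DIM('m) + dim (L p) + 1"
proof -
  have "push_space A f p \<inter> L p = {0}"
    using push_normal_disjoint assms subspace_0[OF subspace_push_space] subspace_0[OF assms(1)] by blast
  moreover have "span (push_space A f p \<union> L p) = {x + y | x y. x \<in> push_space A f p \<and> y \<in> L p}"
    using assms(1) subspace_push_space by (auto simp: span_Un span_eq_iff[THEN iffD2])
  moreover have "dim {0 :: (real \<times> 'n) \<times> real} = 0" by (simp add: dim_eq_0)
  ultimately have "dim (span (push_space A f p \<union> L p)) = DIM('m) + dim (L p)"
    using dim_sums_Int[OF subspace_push_space assms(1), of p] dim_push_space[of p] by simp
  then have "dim (push_space A f p \<union> L p) = DIM('m) + dim (L p)" by simp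
  moreover have "(fst (f p), 0) \<notin> span (push_space A f p \<union> L p)"
  proof
    have "L p \<subseteq> tangent_QR \<epsilon> (f p)" using assms(2) by (auto simp: normal_fibre_def)
    then have "span (push_space A f p \<union> L p) \<subseteq> tangent_QR \<epsilon> (f p)"
      by (intro span_minimal Un_least push_space_tangent subspace_tangent_QR)
    moreover assume "(fst (f p), 0) \<in> span (push_space A f p \<union> L p)"
    ultimately have "form \<epsilon> (fst (f p)) (fst (f p)) = 0" by (auto simp: tangent_QR_def)
    then show False using f_QR[of p] \<epsilon> by (auto simp: QR_def Q_def)
  qed
  ultimately show ?thesis by (simp add: adapted_space_def dim_insert)
qed

text \<open>A flat vector is the sum of a tangential, a normal and a radial part. The adapted space
  contains all tangential and radial vectors, so only the normal part has to be checked. The Gauss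
  and Weingarten formulas enter in this form.\<close>

lemma mem_adapted_spaceI:
  assumes "normal_part \<epsilon> A f p (tan_proj \<epsilon> (f p) X) \<in> L p"
  shows "X \<in> adapted_space A f L p"
proof -
  let ?Y = "tan_proj \<epsilon> (f p) X"
  have "?Y - normal_part \<epsilon> A f p ?Y \<in> push_space A f p"
    by (rule tangential_part[OF tan_proj_tangent[OF \<epsilon> f_QR]])
  then have "(?Y - normal_part \<epsilon> A f p ?Y) + normal_part \<epsilon> A f p ?Y
      + (\<epsilon> * form \<epsilon> (fst X) (fst (f p))) *\<^sub>R (fst (f p), 0) \<in> adapted_space A f L p"
    unfolding adapted_space_def using assms by (intro span_add span_scale) (auto intro: span_base)
  then show ?thesis by (simp add: tan_proj_def)
qed

lemma adapted_space_parallel: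
  assumes L: "\<And>p. L p = {\<xi> + \<zeta> | \<xi> \<zeta>. \<xi> \<in> first_normal_space \<epsilon> A f p \<and> \<zeta> \<in> span {\<eta> p}}"
    and \<eta>: "\<And>p c. c \<in> charts_at A p \<Longrightarrow> dt = dmap c f p (T c p) + \<eta> p"
    and conn: "normal_conn_maps_into \<epsilon> A f (first_normal_space \<epsilon> A f) L"
  shows "dt \<in> adapted_space A f L p" (is ?dt)
    and "adapted_space A f L p \<subseteq> {F p | F U. p \<in> U \<and> parallel_section A (adapted_space A f L) U F}" (is ?sections)
proof -
  let ?V = "adapted_space A f L"
  have V: "subspace (?V q)" for q unfolding adapted_space_def by (rule subspace_span)
  have push: "push_space A f q \<subseteq> ?V q" and LV: "L q \<subseteq> ?V q" and radial: "(fst (f q), 0) \<in> ?V q" for q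
    unfolding adapted_space_def by (auto intro: span_base)
  have N1: "first_normal_space \<epsilon> A f q \<subseteq> L q" for q
  proof
    fix \<xi> assume "\<xi> \<in> first_normal_space \<epsilon> A f q"
    then show "\<xi> \<in> L q"
      unfolding L by (intro CollectI exI[of _ \<xi>] exI[of _ 0]) (simp add: span_zero)
  qed
  have \<eta>L: "\<eta> q \<in> L q" for q
    unfolding L using span_base[of "\<eta> q" "{\<eta> q}"] span_zero
    by (intro CollectI exI[of _ 0] exI[of _ "\<eta> q"]) (auto simp: first_normal_space_def)
  have ff: "second_ff \<epsilon> A f c q u v \<in> first_normal_space \<epsilon> A f q" if "c \<in> charts_at A q" for c q u v
    unfolding first_normal_space_def using that by (intro span_base) blast
  have dt: "dt \<in> ?V q" for q
  proof -
    obtain c where c: "c \<in> charts_at A q" using charts_at_nonempty[OF atlas] by blast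
    have "dmap c f q (T c q) \<in> ?V q" using push push_space_eq[OF c] by blast
    then show ?thesis unfolding \<eta>[OF c] using \<eta>L LV V by (blast intro: subspace_add)
  qed
  then show ?dt by blast
  \<comment> \<open>Gauss formula: the normal part of the derivative is a value of the second
    fundamental form. Directions given in another chart \<open>d\<close> are first converted to
    components in \<open>c\<close>.\<close>
  have df_section: "parallel_section A ?V (fst c) (\<lambda>q. dmap c f q v)" if c: "c \<in> A" for c v
    unfolding parallel_section_def
  proof (intro conjI ballI allI)
    show "open (fst c)" by (rule chart_homeomorphism(1)[OF atlas c])
    show "smooth_map A (fst c) (\<lambda>q. dmap c f q v)" by (rule smooth_df[OF c])
    fix q assume q: "q \<in> fst c"
    then have cq: "c \<in> charts_at A q" using c by (simp add: charts_at_def)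
    show "dmap c f q v \<in> ?V q" using push push_space_eq[OF cq] by blast
    fix d u assume d: "d \<in> charts_at A q"
    let ?u = "dmap d (snd c) q u"
    have "normal_part \<epsilon> A f q (tan_proj \<epsilon> (f q) (dmap c (\<lambda>q. dmap c f q v) q ?u)) \<in> L q"
      using ff[OF cq, of ?u v] N1 unfolding second_ff_def cov_deriv_def by blast
    then show "dmap d (\<lambda>q. dmap c f q v) q u \<in> ?V q"
      unfolding dmap_chart_change[OF atlas smooth_df[OF c] q cq d] by (rule mem_adapted_spaceI)
  qed
  \<comment> \<open>Weingarten formula: here \<open>conn\<close> is applied, on the whole chart
    domain, to the second fundamental form of two coordinate fields.\<close>
  have ff_section: "parallel_section A ?V (fst c) (\<lambda>q. second_ff \<epsilon> A f c q u v)" if c: "c \<in> A" for c u v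
    unfolding parallel_section_def
  proof (intro conjI ballI allI)
    let ?\<xi> = "\<lambda>q. second_ff \<epsilon> A f c q u v"
    show op: "open (fst c)" by (rule chart_homeomorphism(1)[OF atlas c])
    show sm: "smooth_map A (fst c) ?\<xi>" by (rule smooth_second_ff[OF c])
    have N: "?\<xi> q \<in> first_normal_space \<epsilon> A f q" if "q \<in> fst c" for q
      using ff that c by (simp add: charts_at_def)
    fix q assume q: "q \<in> fst c"
    show "?\<xi> q \<in> ?V q" using N[OF q] N1 LV by blast
    fix d w assume d: "d \<in> charts_at A q"
    have "normal_conn \<epsilon> A f d ?\<xi> q w \<in> L q"
      using conn op sm N q d unfolding normal_conn_maps_into_def by blast
    then show "dmap d ?\<xi> q w \<in> ?V q"
      unfolding normal_conn_def cov_deriv_def by (rule mem_adapted_spaceI)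
  qed
  have radial_section: "parallel_section A ?V UNIV (\<lambda>q. (fst (f q), 0))"
    unfolding parallel_section_def
  proof (intro conjI ballI allI)
    have bl: "bounded_linear (\<lambda>z::(real \<times> 'n) \<times> real. (fst z, 0 :: real))"
      by (intro bounded_linear_Pair bounded_linear_fst bounded_linear_zero)
    show "smooth_map A UNIV (\<lambda>q. (fst (f q), 0 :: real))"
      unfolding smooth_map_def
    proof
      fix c assume c: "c \<in> A"
      have "smooth_on (snd c ` (fst c \<inter> UNIV)) (f \<circ> param c)"
        using f_smooth c unfolding smooth_map_def by blast
      from smooth_on_bounded_linear[OF bl open_chart_image[OF atlas c open_UNIV] this]
      show "smooth_on (snd c ` (fst c \<inter> UNIV)) ((\<lambda>q. (fst (f q), 0 :: real)) \<circ> param c)"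
        by (simp add: o_def)
    qed
    fix q
    show "(fst (f q), 0) \<in> ?V q" by (rule radial)
    fix d u assume d: "d \<in> charts_at A q"
    have "dmap d (\<lambda>q. (fst (f q), 0 :: real)) q u = (fst (dmap d f q u), 0)"
      using bounded_linear.has_derivative[OF bl dmap_has_derivative[OF atlas f_smooth UNIV_I d]]
      by (intro dmap_eqI[OF atlas]) (simp add: o_def)
    also have "\<dots> = dmap d f q u - snd (dmap d f q u) *\<^sub>R dt"
      by (simp add: dt_def prod_eq_iff)
    also have "\<dots> \<in> ?V q"
    proof (rule subspace_diff[OF V _ subspace_scale[OF V dt]])
      show "dmap d f q u \<in> ?V q" using push push_space_eq[OF d] by blast
    qed
    finally show "dmap d (\<lambda>q. (fst (f q), 0 :: real)) q u \<in> ?V q" .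
  qed simp
  define E where "E = {F p | F U. p \<in> U \<and> parallel_section A ?V U F}"
  have E: "subspace E" unfolding E_def by (rule subspace_parallel_values[OF atlas V])
  have EI: "F p \<in> E" if "p \<in> U" "parallel_section A ?V U F" for F U using that unfolding E_def by blast
  have df_E: "dmap c f p v \<in> E" if "c \<in> charts_at A p" for c v
    by (rule EI[OF _ df_section]) (use that in \<open>simp_all add: charts_at_def\<close>)
  have "first_normal_space \<epsilon> A f p \<subseteq> E"
    unfolding first_normal_space_def
  proof (rule span_minimal[OF _ E], rule subsetI)
    fix x assume "x \<in> {second_ff \<epsilon> A f c p u v | c u v. c \<in> charts_at A p}"
    then obtain c u v where "x = second_ff \<epsilon> A f c p u v" "c \<in> A" "p \<in> fst c"
      by (auto simp: charts_at_def)
    then show "x \<in> E" using EI[OF \<open>p \<in> fst c\<close> ff_section[OF \<open>c \<in> A\<close>], of u v] by simp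
  qed
  \<comment> \<open>Only the value at \<open>p\<close> matters, so \<open>T c p\<close> is frozen to
    constant components: \<open>\<eta> p\<close> is the value of the constant section
    \<open>dt\<close> minus that of a section \<open>dmap c f q v\<close> with fixed
    \<open>v\<close>.\<close>
  moreover have "\<eta> p \<in> E"
  proof -
    obtain c where c: "c \<in> charts_at A p" using charts_at_nonempty[OF atlas] by blast
    have "dt \<in> E" using EI[OF UNIV_I parallel_section_const[OF atlas dt V]] .
    then have "dt - dmap c f p (T c p) \<in> E" by (rule subspace_diff[OF E _ df_E[OF c]])
    then show ?thesis by (simp add: \<eta>[OF c])
  qed
  then have "span {\<eta> p} \<subseteq> E" by (intro span_minimal[OF _ E] insert_subsetI) auto
  ultimately have "L p \<subseteq> E"
    unfolding L using subspace_add[OF E] by blast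
  moreover have "push_space A f p \<subseteq> E"
    unfolding push_space_def by (intro UN_least image_subsetI df_E)
  moreover have "(fst (f p), 0) \<in> E" using EI[OF UNIV_I radial_section] .
  ultimately have "adapted_space A f L p \<subseteq> E"
    unfolding adapted_space_def by (intro span_minimal[OF _ E]) simp
  then show ?sections unfolding E_def .
qed

end

section \<open>The slice cut out by the constant subspace\<close>

theorem lemma6:
  fixes \<epsilon> :: real
    and A :: "('p::{t2_space, second_countable_topology}, 'm::euclidean_space) chart set"
    and g :: "('p, 'm) chart \<Rightarrow> 'p \<Rightarrow> 'm \<Rightarrow> 'm \<Rightarrow> real"
    and f :: "'p \<Rightarrow> (real \<times> 'n::euclidean_space) \<times> real"
    and T :: "('p, 'm) chart \<Rightarrow> 'p \<Rightarrow> 'm"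
    and \<eta> :: "'p \<Rightarrow> (real \<times> 'n) \<times> real"
    and L :: "'p \<Rightarrow> ((real \<times> 'n) \<times> real) set"
    and l :: nat
  assumes "\<epsilon> \<in> {-1, 1}"
    and "smooth_atlas A"
    and "connected (UNIV :: 'p set)"
    and "riemannian_metric A g"
    and "isometric_immersion \<epsilon> A g f"
    and "\<And>p. \<eta> p \<in> normal_fibre \<epsilon> A f p"
    and "\<And>p c. c \<in> charts_at A p \<Longrightarrow> dt = dmap c f p (T c p) + \<eta> p"
    and "\<And>p. L p = {\<xi> + \<zeta> | \<xi> \<zeta>. \<xi> \<in> first_normal_space \<epsilon> A f p \<and> \<zeta> \<in> span {\<eta> p}}"
    and "normal_subbundle \<epsilon> A f L l"
    and "int l < int DIM('n) + 1 - int DIM('m)"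
    and "normal_conn_maps_into \<epsilon> A f (first_normal_space \<epsilon> A f) L"
  shows "reduces_codimension_to \<epsilon> A f l"
proof -
  note \<epsilon> = assms(1) and atlas = assms(2) and immersion = assms(5)
  define V where "V = adapted_space A f L"
  have "L p = span (first_normal_space \<epsilon> A f p \<union> {\<eta> p})" for p
    unfolding assms(8) span_Un first_normal_space_def span_span ..
  then have "subspace (L p)" for p by simp
  moreover have "dim (L p) = l" for p
  proof -
    from assms(9) obtain U E where "p \<in> U" and frame: "\<forall>q\<in>U. inj_on (\<lambda>i. E i q) {..<l} \<and>
        independent ((\<lambda>i. E i q) ` {..<l}) \<and> span ((\<lambda>i. E i q) ` {..<l}) = L q"
      unfolding normal_subbundle_def by meson
    note E = bspec[OF frame \<open>p \<in> U\<close>]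
    have "dim (L p) = dim (span ((\<lambda>i. E i p) ` {..<l}))" using E by simp
    also have "\<dots> = card ((\<lambda>i. E i p) ` {..<l})" using E by (intro dim_span_eq_card_independent) blast
    also have "\<dots> = l" using E by (simp add: card_image)
    finally show ?thesis .
  qed
  moreover have "L p \<subseteq> normal_fibre \<epsilon> A f p" for p
    using assms(9) unfolding normal_subbundle_def by blast
  ultimately have dim_V: "dim (V p) = DIM('m) + l + 1" for p
    unfolding V_def using dim_adapted_space[OF \<epsilon> atlas immersion] by simp
  have sub_V: "subspace (V p)" for p by (simp add: V_def adapted_space_def)
  note par = adapted_space_parallel[OF \<epsilon> atlas immersion assms(8,7,11), folded V_def]
  have const: "V p = V q" for p q
    by (rule parallel_distribution_constant[OF atlas assms(3) sub_V dim_V par(2)])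
  \<comment> \<open>The manifold is a whole type, hence nonempty, and has a base point.\<close>
  obtain p0 :: 'p where True by blast
  define W where "W = (\<lambda>x. (x, 0::real)) -` V p0"
  have "linear (\<lambda>x :: real \<times> 'n. (x, 0::real))" by (rule linearI) auto
  then have sub_W: "subspace W" unfolding W_def by (rule linear_subspace_vimage[OF _ sub_V])
  \<comment> \<open>Multiples of \<open>dt\<close> can be added freely in \<open>V p0\<close>, so
    membership depends on the first component only.\<close>
  have "V p0 = W \<times> UNIV"
  proof (intro set_eqI)
    fix z :: "(real \<times> 'n) \<times> real"
    have dt: "r *\<^sub>R dt \<in> V p0" for r by (rule subspace_scale[OF sub_V par(1)])
    have "(fst z, 0) + snd z *\<^sub>R dt = z" "z - snd z *\<^sub>R dt = (fst z, 0)"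
      by (simp_all add: dt_def prod_eq_iff)
    then have "z \<in> V p0 \<longleftrightarrow> (fst z, 0) \<in> V p0"
      using subspace_add[OF sub_V _ dt, of "(fst z, 0)" "snd z"] subspace_diff[OF sub_V _ dt, of z "snd z"]
      by metis
    then show "z \<in> V p0 \<longleftrightarrow> z \<in> W \<times> UNIV" by (simp add: W_def mem_Times_iff)
  qed
  then have "dim W + 1 = DIM('m) + l + 1"
    using dim_V[of p0] dim_Times[OF sub_W subspace_UNIV[where 'a = real]] by simp
  \<comment> \<open>\<open>Suc\<close> accounts for the slice being a hypersurface in
    \<open>W\<close>; the truncated subtraction is exact because \<open>DIM('m)\<close> is
    positive.\<close>
  then have dim_W: "dim W = Suc (DIM('m) + l - 1)"
    using DIM_positive[where 'a = 'm] by linarith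
  have f_W: "fst (f p) \<in> W \<inter> Q \<epsilon>" for p
  proof -
    have "(fst (f p), 0) \<in> V p" unfolding V_def adapted_space_def by (rule span_base) simp
    then have "fst (f p) \<in> W" unfolding W_def const[of p p0] by simp
    moreover have "fst (f p) \<in> Q \<epsilon>"
      using f_QR[OF \<epsilon> atlas immersion, of p] unfolding QR_def mem_Times_iff by simp
    ultimately show ?thesis by simp
  qed
  have "space_form_copy \<epsilon> (DIM('m) + l - 1) (W \<inter> Q \<epsilon>)"
    using f_W[of p0] by (intro space_form_copy_slice[OF \<epsilon> _ _ sub_W dim_W]) auto
  moreover have "totally_geodesic \<epsilon> ((W \<inter> Q \<epsilon>) \<times> UNIV)"
    by (rule totally_geodesic_slice[OF \<epsilon> sub_W])
  moreover have "range f \<subseteq> (W \<inter> Q \<epsilon>) \<times> UNIV"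
  proof (rule image_subsetI)
    fix p show "f p \<in> (W \<inter> Q \<epsilon>) \<times> UNIV" unfolding mem_Times_iff using f_W by blast
  qed
  ultimately show ?thesis
    unfolding reduces_codimension_to_def by (intro exI[of _ "W \<inter> Q \<epsilon>"] conjI)
qed

end
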